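(* Let $X\subset \mathbb{R}^2$ be a Borel set, and suppose there exists a line $\ell'\subset\mathbb{R}^2$ such that $\dim (X\setminus \ell')<\dim X$. Further, let $0< t < \dim X$ be such that $\dim (X\setminus \ell)\geq t$ for all lines $\ell\subset\mathbb{R}^2$. Then $$\dim \mathcal L(X) \geq \dim X + t.$$
   Context: $\dim$ denotes Hausdorff dimension. Lines are affine lines (not necessarily through the origin). $\mathcal A(2,1)$ is the set of affine lines in $\mathbb{R}^2$, equipped with the metric $d(\ell,\ell')=\lVert P_W-P_{W'}\rVert_{\mathrm{op}}+|x-x'|$, where $\ell=W+x$ and $\ell'=W'+x'$ with $W,W'$ one-dimensional linear subspaces, $x\in W^\perp$, $x'\in (W')^\perp$, and $P_W$ is orthogonal projection onto $W$. For $X\subset\mathbb{R}^2$, $\mathcal L(X):=\{\ell\in\mathcal A(2,1): |X\cap\ell|\geq 2\}$ is the set of lines containing at least two points of $X$; its Hausdorff dimension is taken with respect to the metric $d(\ell,\ell')=\lVert P_W-P_{W'}\rVert_{\mathrm{op}}+|x-x'|$ on $\mathcal A(2,1)$. *)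

theory Defs
  imports "HOL-Analysis.Analysis"
begin

section \<open>Hausdorff dimension in a metric space\<close>

definition ediameter :: "'a metric \<Rightarrow> 'a set \<Rightarrow> ennreal" where
  "ediameter m U = (SUP x\<in>U. SUP y\<in>U. ennreal (mdist m x y))"

text \<open>The \<open>s\<close>-th power of the diameter, with \<open>0\<^sup>0 = 1\<close> for nonempty sets (whereas \<open>0 powr 0 = 0\<close>).
  It is only used for sets of finite diameter, where \<^const>\<open>enn2real\<close> loses nothing.\<close>

definition diam_powr :: "'a metric \<Rightarrow> real \<Rightarrow> 'a set \<Rightarrow> ennreal" where
  "diam_powr m s U =
     (if U = {} then 0 else if s = 0 then 1 else ennreal (enn2real (ediameter m U) powr s))"

definition hausdorff_premeasure :: "'a metric \<Rightarrow> real \<Rightarrow> real \<Rightarrow> 'a set \<Rightarrow> ennreal" where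
  "hausdorff_premeasure m s \<delta> E =
     (INF U \<in> {U :: nat \<Rightarrow> 'a set. E \<subseteq> (\<Union>i. U i) \<and>
                 (\<forall>i. U i \<subseteq> mspace m \<and> ediameter m (U i) \<le> ennreal \<delta>)}.
        \<Sum>i. diam_powr m s (U i))"

definition hausdorff_measure :: "'a metric \<Rightarrow> real \<Rightarrow> 'a set \<Rightarrow> ennreal" where
  "hausdorff_measure m s E = (SUP \<delta>\<in>{0<..}. hausdorff_premeasure m s \<delta> E)"

definition hausdorff_dim :: "'a metric \<Rightarrow> 'a set \<Rightarrow> ennreal" where
  "hausdorff_dim m E = (INF s \<in> {s. 0 \<le> s \<and> hausdorff_measure m s E = 0}. ennreal s)"


section \<open>The metric space of affine lines in the plane\<close>

definition affine_lines :: "(real^2) set set" where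
  "affine_lines = {l. affine l \<and> aff_dim l = 1}"

definition orth_proj :: "'a::euclidean_space set \<Rightarrow> 'a \<Rightarrow> 'a" where
  "orth_proj W v = (THE p. p \<in> W \<and> v - p \<in> W\<^sup>\<bottom>)"

text \<open>For \<open>l = W + x\<close> with \<open>W\<close> a linear subspace and \<open>x \<in> W\<^sup>\<bottom>\<close>, the following two operations
  recover \<open>W\<close> and \<open>x\<close>; see \<open>line_direction_eq\<close>, \<open>line_foot_eq\<close> and \<open>affine_lines_iff\<close> below.\<close>

definition line_direction :: "'a::euclidean_space set \<Rightarrow> 'a set" where
  "line_direction l = {u - v | u v. u \<in> l \<and> v \<in> l}"

definition line_foot :: "'a::euclidean_space set \<Rightarrow> 'a" where
  "line_foot l = (THE x. x \<in> l \<and> x \<in> (line_direction l)\<^sup>\<bottom>)"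

text \<open>The locale \<^locale>\<open>Metric_space\<close> demands nonnegativity and symmetry outside the carrier too, whence
  the value \<open>0\<close> there.\<close>

definition line_dist :: "(real^2) set \<Rightarrow> (real^2) set \<Rightarrow> real" where
  "line_dist l l' =
     (if l \<in> affine_lines \<and> l' \<in> affine_lines
      then onorm (\<lambda>v. orth_proj (line_direction l) v - orth_proj (line_direction l') v)
           + norm (line_foot l - line_foot l')
      else 0)"

definition line_metric :: "(real^2) set metric" where
  "line_metric = metric (affine_lines, line_dist)"

definition spanned_lines :: "(real^2) set \<Rightarrow> (real^2) set set" where
  "spanned_lines X = {l \<in> affine_lines. \<exists>x y. x \<in> X \<inter> l \<and> y \<in> X \<inter> l \<and> x \<noteq> y}"


section \<open>Well-definedness of the metric on lines\<close>

lemma orthogonal_comp_Int_eq_0: "a \<in> W \<Longrightarrow> a \<in> W\<^sup>\<bottom> \<Longrightarrow> a = 0"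
  by (auto simp: orthogonal_comp_def orthogonal_def)

lemma line_direction_eq:
  fixes W :: "'a::euclidean_space set"
  assumes "subspace W"
  shows "line_direction ((+) x ` W) = W"
proof -
  have "w \<in> line_direction ((+) x ` W)" if "w \<in> W" for w
  proof -
    have "w = (x + w) - (x + 0)" "x + w \<in> (+) x ` W" "x + 0 \<in> (+) x ` W"
      using that subspace_0[OF assms] by (simp, blast, blast)
    then show ?thesis unfolding line_direction_def by blast
  qed
  then show ?thesis
    using subspace_diff[OF assms] by (auto simp: line_direction_def)
qed

lemma line_foot_eq:
  fixes W :: "'a::euclidean_space set"
  assumes W: "subspace W" and x: "x \<in> W\<^sup>\<bottom>"
  shows "line_foot ((+) x ` W) = x"
  unfolding line_foot_def line_direction_eq[OF W]
proof (rule the_equality)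
  show "x \<in> (+) x ` W \<and> x \<in> W\<^sup>\<bottom>"
    using x subspace_0[OF W] by force
next
  fix y assume y: "y \<in> (+) x ` W \<and> y \<in> W\<^sup>\<bottom>"
  then obtain w where w: "w \<in> W" "y = x + w" by blast
  have "y - x \<in> W\<^sup>\<bottom>"
    using y x subspace_diff[OF subspace_orthogonal_comp] by blast
  then show "y = x" using w orthogonal_comp_Int_eq_0[of w W] by simp
qed

lemma orth_proj:
  fixes W :: "'a::euclidean_space set"
  assumes W: "subspace W"
  shows "orth_proj W v \<in> W" and "v - orth_proj W v \<in> W\<^sup>\<bottom>"
    and "p \<in> W \<Longrightarrow> v - p \<in> W\<^sup>\<bottom> \<Longrightarrow> orth_proj W v = p"
proof -
  have unique: "p = q" if "p \<in> W" "v - p \<in> W\<^sup>\<bottom>" "q \<in> W" "v - q \<in> W\<^sup>\<bottom>" for p q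
  proof -
    have "p - q \<in> W" using that subspace_diff[OF W] by blast
    moreover have "(v - q) - (v - p) \<in> W\<^sup>\<bottom>"
      using that subspace_diff[OF subspace_orthogonal_comp] by blast
    ultimately show ?thesis using orthogonal_comp_Int_eq_0[of "p - q" W] by simp
  qed
  obtain y z where yz: "y \<in> span W" "\<And>w. w \<in> span W \<Longrightarrow> orthogonal z w" "v = y + z"
    using orthogonal_subspace_decomp_exists by blast
  have "span W = W" using W by (simp add: span_eq_iff)
  note yz' = yz[unfolded this]
  have "y \<in> W \<and> v - y \<in> W\<^sup>\<bottom>"
    using yz' by (auto simp: orthogonal_comp_def orthogonal_commute)
  then have "\<exists>!p. p \<in> W \<and> v - p \<in> W\<^sup>\<bottom>" using unique by blast
  from theI'[OF this] show *: "orth_proj W v \<in> W" "v - orth_proj W v \<in> W\<^sup>\<bottom>"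
    unfolding orth_proj_def by blast+
  show "p \<in> W \<Longrightarrow> v - p \<in> W\<^sup>\<bottom> \<Longrightarrow> orth_proj W v = p"
    using unique * by blast
qed

lemma bounded_linear_orth_proj:
  fixes W :: "'a::euclidean_space set"
  assumes W: "subspace W"
  shows "bounded_linear (orth_proj W)"
proof -
  note P = orth_proj[OF W] and S = subspace_orthogonal_comp[of W]
  have "linear (orth_proj W)"
  proof (rule linearI)
    fix a b
    have "(a - orth_proj W a) + (b - orth_proj W b) \<in> W\<^sup>\<bottom>"
      using P(2) subspace_add[OF S] by blast
    then show "orth_proj W (a + b) = orth_proj W a + orth_proj W b"
      by (intro P(3) subspace_add[OF W] P(1)) (simp add: algebra_simps)
  next
    fix c a
    have "c *\<^sub>R (a - orth_proj W a) \<in> W\<^sup>\<bottom>"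
      using P(2) subspace_scale[OF S] by blast
    then show "orth_proj W (c *\<^sub>R a) = c *\<^sub>R orth_proj W a"
      by (intro P(3) subspace_scale[OF W] P(1)) (simp add: algebra_simps)
  qed
  then show ?thesis by (rule linear_conv_bounded_linear[THEN iffD1])
qed

lemma orth_proj_inject:
  fixes W :: "'a::euclidean_space set"
  assumes W: "subspace W" "subspace W'" and eq: "\<And>v. orth_proj W v = orth_proj W' v"
  shows "W = W'"
proof -
  have "v \<in> U \<longleftrightarrow> orth_proj U v = v" if "subspace U" for U :: "'a set" and v
    using orth_proj[OF that, of v] orth_proj(3)[OF that, of v v]
      subspace_0[OF subspace_orthogonal_comp[of U]] by auto
  then show ?thesis using W eq by auto
qed

lemma affine_lines_iff:
  "l \<in> affine_lines \<longleftrightarrow>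
     (\<exists>W x. subspace W \<and> dim W = 1 \<and> x \<in> W\<^sup>\<bottom> \<and> l = (+) x ` W)"
proof
  assume "l \<in> affine_lines"
  then have l: "affine l" "aff_dim l = 1" by (auto simp: affine_lines_def)
  then obtain a where a: "a \<in> l" by force
  define W where "W = (+) (- a) ` l"
  have W: "subspace W"
    using affine_diffs_subspace[OF l(1) a] by (simp add: W_def)
  have "int (dim W) = 1"
    using aff_dim_dim_affine_diffs[OF l(1) a] l(2) by (simp add: W_def)
  have lW: "l = (+) a ` W" by (simp add: W_def image_image)
  define x where "x = a - orth_proj W a"
  have "(+) x ` W = l"
  proof -
    have "(+) (- orth_proj W a) ` W = W"
    proof (intro equalityI subsetI)
      fix w assume "w \<in> W"
      then have "orth_proj W a + w \<in> W" by (rule subspace_add[OF W orth_proj(1)[OF W]])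
      then show "w \<in> (+) (- orth_proj W a) ` W"
        by (rule rev_image_eqI) simp
    qed (use subspace_diff[OF W _ orth_proj(1)[OF W]] in auto)
    then have "(+) a ` ((+) (- orth_proj W a) ` W) = l" using lW by simp
    then show ?thesis by (simp add: image_image x_def algebra_simps)
  qed
  moreover have "x \<in> W\<^sup>\<bottom>" unfolding x_def by (rule orth_proj(2)[OF W])
  ultimately show "\<exists>W x. subspace W \<and> dim W = 1 \<and> x \<in> W\<^sup>\<bottom> \<and> l = (+) x ` W"
    using W \<open>int (dim W) = 1\<close> by (intro exI[of _ W] exI[of _ x]) auto
next
  assume "\<exists>W x. subspace W \<and> dim W = 1 \<and> x \<in> W\<^sup>\<bottom> \<and> l = (+) x ` W"
  then show "l \<in> affine_lines"
    by (auto simp: affine_lines_def affine_translation [symmetric] aff_dim_translation_eq aff_dim_subspace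
        subspace_imp_affine)
qed

lemma line_dist_eq:
  assumes "subspace W" "dim W = 1" "x \<in> W\<^sup>\<bottom>" "subspace W'" "dim W' = 1" "x' \<in> W'\<^sup>\<bottom>"
  shows "line_dist ((+) x ` W) ((+) x' ` W') =
           onorm (\<lambda>v. orth_proj W v - orth_proj W' v) + norm (x - x')"
proof -
  have "(+) x ` W \<in> affine_lines" "(+) x' ` W' \<in> affine_lines"
    using assms unfolding affine_lines_iff by blast+
  then show ?thesis
    using assms by (simp add: line_dist_def line_direction_eq line_foot_eq)
qed

lemma Metric_space_lines: "Metric_space affine_lines line_dist"
proof -
  let ?D = "\<lambda>l l'. (\<lambda>v. orth_proj (line_direction l) v - orth_proj (line_direction l') v)"
  have dir: "subspace (line_direction l)" and decomp: "l = (+) (line_foot l) ` line_direction l"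
    if "l \<in> affine_lines" for l
    using that by (auto simp: affine_lines_iff line_direction_eq line_foot_eq)
  have bl: "bounded_linear (?D l l')" if "l \<in> affine_lines" "l' \<in> affine_lines" for l l'
    by (intro bounded_linear_sub bounded_linear_orth_proj dir that)
  show ?thesis
  proof
    fix l l'
    show "0 \<le> line_dist l l'"
      using onorm_pos_le[OF bl] by (simp add: line_dist_def)
    show "line_dist l l' = line_dist l' l"
      using onorm_neg[of "?D l l'"] by (simp add: line_dist_def norm_minus_commute)
  next
    fix l l' assume l: "l \<in> affine_lines" "l' \<in> affine_lines"
    show "line_dist l l' = 0 \<longleftrightarrow> l = l'"
    proof
      assume "line_dist l l' = 0"
      then have "onorm (?D l l') = 0" "line_foot l = line_foot l'"
        using l onorm_pos_le[OF bl[OF l]] by (auto simp: line_dist_def add_nonneg_eq_0_iff)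
      moreover from this have "line_direction l = line_direction l'"
        using onorm_eq_0[OF bl[OF l]] orth_proj_inject[OF dir dir] l by simp
      ultimately show "l = l'"
        using decomp l by metis
    qed (use l in \<open>simp add: line_dist_def onorm_zero\<close>)
  next
    fix l l' l'' assume l: "l \<in> affine_lines" "l' \<in> affine_lines" "l'' \<in> affine_lines"
    have "onorm (?D l l'') \<le> onorm (?D l l') + onorm (?D l' l'')"
      using onorm_triangle[OF bl[OF l(1,2)] bl[OF l(2,3)]] by simp
    moreover have "norm (line_foot l - line_foot l'')
        \<le> norm (line_foot l - line_foot l') + norm (line_foot l' - line_foot l'')"
      using norm_triangle_ineq[of "line_foot l - line_foot l'" "line_foot l' - line_foot l''"]
      by simp
    ultimately show "line_dist l l'' \<le> line_dist l l' + line_dist l' l''"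
      using l by (simp add: line_dist_def)
  qed
qed

lemma mspace_line_metric: "mspace line_metric = affine_lines"
  and mdist_line_metric: "mdist line_metric = line_dist"
  by (simp_all add: line_metric_def Metric_space.mspace_metric[OF Metric_space_lines]
      Metric_space.mdist_metric[OF Metric_space_lines])

end

theory Submission
  imports Defs "HOL-Library.Sublist" "HOL-Library.Nat_Bijection"
begin

text \<open>
  The set \<open>X \<inter> l'\<close> has dimension \<open>dim X\<close>, and a line meeting \<open>l'\<close> transversally is determined by
  its point \<open>a\<close> on \<open>l'\<close> and its slope relative to \<open>l'\<close>. Take Frostman measures \<open>\<mu>\<close> on \<open>X \<inter> l'\<close> with
  exponent \<open>s < dim X\<close> and \<open>\<nu>\<close> on \<open>X - l'\<close> with exponent below \<open>t\<close>. After a projective transformation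
  the slopes seen from \<open>a\<close> are orthogonal projections, and Kaufman's argument shows that for \<open>\<mu>\<close>-typical
  \<open>a\<close> the radial projection of \<open>\<nu>\<close> from \<open>a\<close> is still Frostman with any exponent \<open>u < t\<close>, locally around
  a typical \<open>b\<close>. Hence a set of lines of diameter \<open>\<delta>\<close> carries at most a constant times
  \<open>\<delta> powr (s + u)\<close> of the image of \<open>\<mu> \<Otimes> \<nu>\<close>, and the mass distribution principle applies.

  Frostman's lemma for Borel sets is obtained on the space of sequences: the net content is
  continuous along increasing sequences of sets, so analytic sets are capacitable, and a compact set of
  positive content carries a flow on the tree of words dominated by the content.
\<close>

section \<open>Analytic sets\<close>

text \<open>The exponents \<open>s\<close> and \<open>u\<close> add because the product measure is
  estimated fibrewise: a set of lines of small diameter confines the base point on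
  \<open>l'\<close>, and over each base point it confines the slope. The obstacle is that the radial
  projection from a single \<open>a\<close> may collapse \<open>\<nu>\<close>; only an average over
  \<open>a\<close> rules this out. Points \<open>b\<close>, \<open>b'\<close> at distance about 2^j
  r are seen under slopes within \<open>r\<close> only from base points in an interval of length
  about 2^(-j), of \<open>\<mu>\<close>-mass about 2^(-j s), while such \<open>b'\<close> have
  \<open>\<nu>\<close>-mass about (2^j r)^t. The series of 2^(j (t - s)) converges because t < s.
  This is why \<open>t\<close> must lie below dim X, and why the exceptional line matters: it
  carries measures of exponents close to dim X on a single line, where the slopes serve as a second,
  independent parameter. The detour through sequences has its reason in the cylinders: any two are
  nested or disjoint, so two covers have a join and a meet of the same total weight. This modular
  law drives the capacitability argument, which a general Borel set requires before any compactness
  can be used.\<close>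

lemma borel_imp_analytic:
  fixes E :: "'a::metric_space set"
  assumes "E \<in> sets borel"
  obtains C :: "((nat \<Rightarrow> nat) \<times> 'a) set" where "closed C" "E = snd ` C"
proof -
  define an where "an E \<longleftrightarrow> (\<exists>C :: ((nat \<Rightarrow> nat) \<times> 'a) set. closed C \<and> E = snd ` C)" for E :: "'a set"
  have closed: "an S" if "closed S" for S
    unfolding an_def
    by (rule exI[of _ "UNIV \<times> S"]) (auto intro!: closed_Times that)
  have Un: "an (\<Union>n. S n)" if S: "\<And>n. an (S n)" for S :: "nat \<Rightarrow> 'a set"
  proof -
    obtain C :: "nat \<Rightarrow> ((nat \<Rightarrow> nat) \<times> 'a) set"
      where C: "\<And>n. closed (C n)" "\<And>n. S n = snd ` C n"
      using S unfolding an_def by metis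
    \<comment> \<open>The first entry of the witness sequence names the set; the tail is the witness
      for that set.\<close>
    define D where "D = {(s, x). (\<lambda>k. s (Suc k), x) \<in> C (s 0)}"
    have "D = (\<Inter>n. {p. fst p 0 \<noteq> n} \<union> (\<lambda>(s, x). (\<lambda>k. s (Suc k), x)) -` C n)"
      by (auto simp: D_def)
    moreover have "closed ({p. fst p 0 \<noteq> n} \<union> (\<lambda>(s, x). (\<lambda>k. s (Suc k), x)) -` C n)" for n :: nat
    proof (intro closed_Un closed_vimage C)
      have "open ((\<lambda>p :: (nat \<Rightarrow> nat) \<times> 'a. fst p 0) -` {n})"
        by (intro open_vimage open_discrete continuous_intros
            continuous_on_compose2[OF continuous_on_product_coordinates]) auto
      moreover have "{p :: (nat \<Rightarrow> nat) \<times> 'a. fst p 0 \<noteq> n} = - ((\<lambda>p. fst p 0) -` {n})"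
        by auto
      ultimately show "closed {p :: (nat \<Rightarrow> nat) \<times> 'a. fst p 0 \<noteq> n}" by (simp add: closed_Compl)
      show "continuous_on UNIV (\<lambda>(s :: nat \<Rightarrow> nat, x :: 'a). (\<lambda>k. s (Suc k), x))"
        unfolding case_prod_unfold
        by (intro continuous_intros continuous_on_coordinatewise_then_product
            continuous_on_compose2[OF continuous_on_product_coordinates]) auto
    qed
    ultimately have "closed D" by (auto intro: closed_INT)
    moreover have "(\<Union>n. S n) = snd ` D"
    proof (intro equalityI subsetI)
      fix x assume "x \<in> (\<Union>n. S n)"
      then obtain n s where "(s, x) \<in> C n" by (auto simp: C)
      then have "(case_nat n s, x) \<in> D" by (simp add: D_def)
      then show "x \<in> snd ` D" by force
    qed (force simp: D_def C)
    ultimately show ?thesis unfolding an_def by blast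
  qed
  have Int: "an (\<Inter>n. S n)" if S: "\<And>n. an (S n)" for S :: "nat \<Rightarrow> 'a set"
  proof -
    obtain C :: "nat \<Rightarrow> ((nat \<Rightarrow> nat) \<times> 'a) set"
      where C: "\<And>n. closed (C n)" "\<And>n. S n = snd ` C n"
      using S unfolding an_def by metis
    \<comment> \<open>One sequence carries witnesses for all the sets at once, the n-th being read
      along the codes of the pairs (n, k).\<close>
    define D where "D = (\<Inter>n. (\<lambda>(s, x). (\<lambda>k. s (prod_encode (n, k)), x)) -` C n)"
    have "closed D"
      unfolding D_def case_prod_unfold
      by (intro closed_INT ballI closed_vimage C continuous_intros
          continuous_on_coordinatewise_then_product
          continuous_on_compose2[OF continuous_on_product_coordinates]) auto
    moreover have "(\<Inter>n. S n) = snd ` D"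
    proof (intro equalityI subsetI)
      fix x assume "x \<in> (\<Inter>n. S n)"
      then have "\<forall>n. \<exists>s. (s, x) \<in> C n" by (force simp: C)
      then obtain s where "\<And>n. (s n, x) \<in> C n" by metis
      then have "(\<lambda>i. case_prod s (prod_decode i), x) \<in> D" by (simp add: D_def)
      then show "x \<in> snd ` D" by force
    qed (force simp: D_def C)
    ultimately show ?thesis unfolding an_def by blast
  qed
  have "open": "an S" if "open S" for S
  proof -
    have "fsigma_in euclidean S"
      using that metrizable_space_euclidean open_imp_fsigma_in by (metis open_openin)
    then obtain C :: "nat \<Rightarrow> 'a set" where "\<And>n. closed (C n)" "(\<Union>n. C n) = S"
      unfolding fsigma_in_ascending by auto
    then show ?thesis using Un[of C] closed by auto
  qed
  have "E \<in> sigma_sets UNIV (Collect open)" using assms by (simp add: borel_def)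
  \<comment> \<open>The class need not be closed under complements, so the induction carries
    \<open>E\<close> and \<open>- E\<close> together; a union for one is an intersection for the
    other.\<close>
  then have "an E \<and> an (- E)"
  proof induction
    case (Compl a)
    then show ?case by (simp add: Compl_eq_Diff_UNIV double_diff)
  next
    case (Union a)
    then show ?case using Un[of a] Int[of "\<lambda>n. - a n"] by auto
  qed (auto intro: closed "open" closed_Compl)
  then show ?thesis using that unfolding an_def by blast
qed

section \<open>Net contents on the sequence space\<close>

definition cyl :: "nat list \<Rightarrow> (nat \<Rightarrow> nat) set" where
  "cyl w = {x. \<forall>i<length w. x i = w ! i}"

lemma cyl_Nil [simp]: "cyl [] = UNIV"
  by (simp add: cyl_def)

lemma cyl_snoc: "cyl (w @ [i]) = {x \<in> cyl w. x (length w) = i}"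
  by (auto simp: cyl_def nth_append less_Suc_eq)

lemma map_in_cyl: "x \<in> cyl (map x [0..<n])"
  by (auto simp: cyl_def)

lemma cyl_mono: "prefix v w \<Longrightarrow> cyl w \<subseteq> cyl v"
  by (auto simp: cyl_def prefix_def nth_append)

lemma cyl_prefix:
  assumes "x \<in> cyl v" "x \<in> cyl w" "length v \<le> length w"
  shows "prefix v w"
proof -
  have "v = take (length v) w"
    using assms by (auto simp: cyl_def list_eq_iff_nth_eq)
  then show ?thesis by (metis take_is_prefix)
qed

lemma open_cyl: "open (cyl w)"
proof -
  have "cyl w = (\<Inter>i\<in>{..<length w}. (\<lambda>x. x i) -` {w ! i})"
    by (auto simp: cyl_def)
  moreover have "open ((\<lambda>x :: nat \<Rightarrow> nat. x i) -` {w ! i})" for i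
    by (intro open_vimage open_discrete continuous_on_product_coordinates)
  ultimately show ?thesis by (auto intro: open_INT)
qed

text \<open>Cylinders are nested or disjoint, so the prefix-minimal words of a family have pairwise
  disjoint cylinders with the same union. Applied to the union of two families this is the join of
  two covers.\<close>

definition minimal_nodes :: "nat list set \<Rightarrow> nat list set" where
  "minimal_nodes S = {w \<in> S. \<forall>v\<in>S. \<not> strict_prefix v w}"

lemma minimal_nodes_below:
  assumes "w \<in> S"
  obtains v where "v \<in> minimal_nodes S" "prefix v w"
proof -
  have "\<exists>v\<in>minimal_nodes S. prefix v w"
    using assms
  proof (induction "length w" arbitrary: w rule: less_induct)
    case less
    show ?case
    proof (cases "w \<in> minimal_nodes S")
      case False
      then obtain v where "v \<in> S" "strict_prefix v w"
        using less.prems by (auto simp: minimal_nodes_def)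
      then show ?thesis
        using less.hyps[of v] prefix_length_less[of v w]
        by (meson prefix_order.less_imp_le prefix_order.trans)
    qed auto
  qed
  then show ?thesis using that by blast
qed

lemma minimal_nodes_cover: "(\<Union>w\<in>minimal_nodes S. cyl w) = (\<Union>w\<in>S. cyl w)"
proof
  show "(\<Union>w\<in>S. cyl w) \<subseteq> (\<Union>w\<in>minimal_nodes S. cyl w)"
  proof
    fix x assume "x \<in> (\<Union>w\<in>S. cyl w)"
    then obtain w where w: "w \<in> S" "x \<in> cyl w" by blast
    obtain v where "v \<in> minimal_nodes S" "prefix v w" using minimal_nodes_below[OF w(1)] .
    then show "x \<in> (\<Union>w\<in>minimal_nodes S. cyl w)" using w cyl_mono by blast
  qed
qed (auto simp: minimal_nodes_def)

lemma minimal_nodes_idem: "minimal_nodes (minimal_nodes S) = minimal_nodes S"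
  by (auto simp: minimal_nodes_def)

lemma minimal_nodes_Un: "minimal_nodes (minimal_nodes S \<union> T) = minimal_nodes (S \<union> T)"
proof (intro equalityI subsetI)
  fix w assume w: "w \<in> minimal_nodes (minimal_nodes S \<union> T)"
  have False if v: "v \<in> S" "strict_prefix v w" for v
  proof -
    obtain u where u: "u \<in> minimal_nodes S" "prefix u v" using minimal_nodes_below[OF v(1)] .
    then have "strict_prefix u w" using v(2) prefix_order.le_less_trans by blast
    then show False using w u(1) by (auto simp: minimal_nodes_def)
  qed
  then show "w \<in> minimal_nodes (S \<union> T)"
    using w by (auto simp: minimal_nodes_def)
qed (auto simp: minimal_nodes_def)

text \<open>Dual to the join: of two comparable words the longer has the smaller cylinder, so the
  words with a prefix in each family cover the intersection of the two unions.\<close>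

definition meet_nodes :: "nat list set \<Rightarrow> nat list set \<Rightarrow> nat list set" where
  "meet_nodes S T = {w \<in> S \<union> T. (\<exists>v\<in>S. prefix v w) \<and> (\<exists>v\<in>T. prefix v w)}"

lemma meet_nodes_cover:
  "(\<Union>w\<in>S. cyl w) \<inter> (\<Union>w\<in>T. cyl w) \<subseteq> (\<Union>w\<in>meet_nodes S T. cyl w)"
proof
  fix x assume "x \<in> (\<Union>w\<in>S. cyl w) \<inter> (\<Union>w\<in>T. cyl w)"
  then obtain v w where vw: "v \<in> S" "w \<in> T" "x \<in> cyl v" "x \<in> cyl w" by blast
  then have "v \<in> meet_nodes S T \<or> w \<in> meet_nodes S T"
    using cyl_prefix[of x v w] cyl_prefix[of x w v]
    by (cases "length v \<le> length w") (auto simp: meet_nodes_def)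
  then show "x \<in> (\<Union>w\<in>meet_nodes S T. cyl w)" using vw by blast
qed

text \<open>A word of only one antichain either is minimal in the union or has a proper prefix in
  the other antichain, and not both; a common word belongs to join and meet alike. Additive weights
  therefore satisfy an exact modular law.\<close>

lemma antichains_join_meet:
  assumes "minimal_nodes S = S" "minimal_nodes T = T"
  shows "minimal_nodes (S \<union> T) \<union> meet_nodes S T = S \<union> T"
    and "minimal_nodes (S \<union> T) \<inter> meet_nodes S T = S \<inter> T"
proof -
  have S: "\<not> strict_prefix v w" if "v \<in> S" "w \<in> S" for v w
    using assms(1) that unfolding minimal_nodes_def by blast
  have T: "\<not> strict_prefix v w" if "v \<in> T" "w \<in> T" for v w
    using assms(2) that unfolding minimal_nodes_def by blast
  show "minimal_nodes (S \<union> T) \<union> meet_nodes S T = S \<union> T"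
    using S T by (auto simp: minimal_nodes_def meet_nodes_def dest: prefix_order.less_imp_le)
  show "minimal_nodes (S \<union> T) \<inter> meet_nodes S T = S \<inter> T"
    using S T
    by (fastforce simp: minimal_nodes_def meet_nodes_def dest: prefix_order.le_imp_less_or_eq)
qed

section \<open>Weighted cylinder covers\<close>

definition node_weight :: "real \<Rightarrow> nat list measure" where
  "node_weight q = density (count_space UNIV) (\<lambda>w. ennreal (q ^ length w))"

lemma sets_node_weight [simp, measurable_cong]: "sets (node_weight q) = UNIV"
  by (simp add: node_weight_def)

lemma emeasure_node_weight:
  "emeasure (node_weight q) S = (\<integral>\<^sup>+w. ennreal (q ^ length w) * indicator S w \<partial>count_space UNIV)"
  by (simp add: node_weight_def emeasure_density)

lemma emeasure_node_weight_singleton: "emeasure (node_weight q) {w} = ennreal (q ^ length w)"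
  by (simp add: emeasure_node_weight)

lemma emeasure_node_weight_mono: "S \<subseteq> T \<Longrightarrow> emeasure (node_weight q) S \<le> emeasure (node_weight q) T"
  by (simp add: emeasure_mono)

lemma emeasure_node_weight_join_meet:
  assumes "minimal_nodes S = S" "minimal_nodes T = T"
  shows "emeasure (node_weight q) (minimal_nodes (S \<union> T)) + emeasure (node_weight q) (meet_nodes S T)
    = emeasure (node_weight q) S + emeasure (node_weight q) T"
  using emeasure_Un_Int[of "minimal_nodes (S \<union> T)" "node_weight q" "meet_nodes S T"]
    emeasure_Un_Int[of S "node_weight q" T] antichains_join_meet[OF assms]
  by (simp add: add.commute)

definition net_content :: "real \<Rightarrow> (nat \<Rightarrow> nat) set \<Rightarrow> ennreal" where
  "net_content q E = (INF S\<in>{S. E \<subseteq> (\<Union>w\<in>S. cyl w)}. emeasure (node_weight q) S)"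

lemma net_content_le: "E \<subseteq> (\<Union>w\<in>S. cyl w) \<Longrightarrow> net_content q E \<le> emeasure (node_weight q) S"
  unfolding net_content_def by (rule INF_lower) simp

lemma net_content_le_power: "E \<subseteq> cyl w \<Longrightarrow> net_content q E \<le> ennreal (q ^ length w)"
  using net_content_le[of E "{w}" q] by (simp add: emeasure_node_weight_singleton)

lemma net_content_le_1: "net_content q E \<le> 1"
  using net_content_le_power[of E "[]" q] by simp

lemma net_content_finite: "net_content q E < top"
  using net_content_le_1 by (metis ennreal_one_less_top le_less_trans)

lemma net_content_empty [simp]: "net_content q {} = 0"
  using net_content_le[of "{}" "{}" q] by simp

lemma net_content_mono: "E \<subseteq> F \<Longrightarrow> net_content q E \<le> net_content q F"
  unfolding net_content_def by (rule INF_superset_mono) auto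

lemma net_content_cover:
  assumes "0 < (e :: ennreal)"
  obtains S where "E \<subseteq> (\<Union>w\<in>S. cyl w)" "emeasure (node_weight q) S < net_content q E + e"
proof -
  have "net_content q E < net_content q E + e"
    using ennreal_add_left_cancel_less[of "net_content q E" 0 e] net_content_finite[of q E] assms
    by (simp add: less_top)
  then show ?thesis using that unfolding net_content_def INF_less_iff by auto
qed

lemma net_content_Un: "net_content q (E \<union> F) \<le> net_content q E + net_content q F"
proof (rule ennreal_le_epsilon)
  fix e :: real assume "0 < e"
  then have e: "0 < ennreal (e / 2)" by simp
  obtain S where S: "E \<subseteq> (\<Union>w\<in>S. cyl w)" "emeasure (node_weight q) S < net_content q E + ennreal (e / 2)"
    using net_content_cover[OF e] .
  obtain T where T: "F \<subseteq> (\<Union>w\<in>T. cyl w)" "emeasure (node_weight q) T < net_content q F + ennreal (e / 2)"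
    using net_content_cover[OF e] .
  have "net_content q (E \<union> F) \<le> emeasure (node_weight q) (S \<union> T)"
    using S T by (intro net_content_le) blast
  also have "\<dots> \<le> emeasure (node_weight q) S + emeasure (node_weight q) T"
    by (rule emeasure_subadditive) auto
  also have "\<dots> \<le> (net_content q E + ennreal (e / 2)) + (net_content q F + ennreal (e / 2))"
    using S T by (intro add_mono) auto
  also have "\<dots> = net_content q E + net_content q F + ennreal e"
  proof -
    have "ennreal e = ennreal (e / 2) + ennreal (e / 2)"
      using \<open>0 < e\<close> by (simp flip: ennreal_plus)
    then show ?thesis by (simp only: ac_simps)
  qed
  finally show "net_content q (E \<union> F) \<le> net_content q E + net_content q F + ennreal e" .
qed

lemma net_content_UN_finite:
  "finite I \<Longrightarrow> net_content q (\<Union>i\<in>I. E i) \<le> (\<Sum>i\<in>I. net_content q (E i))"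
proof (induction rule: finite_induct)
  case (insert i I)
  then show ?case
    using net_content_Un[of q "E i" "\<Union>i\<in>I. E i"] by (auto intro: order_trans add_left_mono)
qed simp

text \<open>The increasing sets lemma: by strong subadditivity, near-optimal covers of the individual sets
  merge into a cover of the union with accumulated errors only.\<close>

lemma net_content_incseq:
  assumes E: "incseq E"
  shows "net_content q (\<Union>n. E n) \<le> (SUP n. net_content q (E n))"
proof (rule ennreal_le_epsilon)
  fix e :: real assume e: "0 < e"
  let ?W = "emeasure (node_weight q)"
  define d where "d n = e * (1 / 2) ^ Suc n" for n
  have d: "0 < d n" for n using e by (simp add: d_def)
  have "\<exists>S. E n \<subseteq> (\<Union>w\<in>S. cyl w) \<and> ?W S \<le> net_content q (E n) + d n \<and> minimal_nodes S = S" for n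
  proof -
    obtain S where S: "E n \<subseteq> (\<Union>w\<in>S. cyl w)" "?W S < net_content q (E n) + d n"
      using net_content_cover[of "ennreal (d n)" "E n" q] d[of n] by auto
    moreover have "?W (minimal_nodes S) \<le> ?W S"
      by (intro emeasure_node_weight_mono) (auto simp: minimal_nodes_def)
    ultimately show ?thesis
      by (intro exI[of _ "minimal_nodes S"]) (auto simp: minimal_nodes_cover minimal_nodes_idem)
  qed
  then obtain S where S: "\<And>n. E n \<subseteq> (\<Union>w\<in>S n. cyl w)"
    "\<And>n. ?W (S n) \<le> net_content q (E n) + d n" "\<And>n. minimal_nodes (S n) = S n"
    by metis
  define T where "T n = minimal_nodes (\<Union>i\<le>n. S i)" for n
  have T_Suc: "T (Suc n) = minimal_nodes (T n \<union> S (Suc n))" for n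
    by (simp add: T_def minimal_nodes_Un atMost_Suc Un_commute[of "S (Suc n)"])
  have T_cover: "E n \<subseteq> (\<Union>w\<in>T n. cyl w)" for n
    unfolding T_def minimal_nodes_cover using S(1) by fastforce
  have W_T: "?W (T n) \<le> net_content q (E n) + ennreal (\<Sum>i\<le>n. d i)" for n
  proof (induction n)
    case 0
    then show ?case using S(2)[of 0] by (simp add: T_def S(3))
  next
    case (Suc n)
    \<comment> \<open>The meet of the old cover with the new one still covers \<open>E n\<close>, so
      it weighs at least \<open>net_content q (E n)\<close>. Cancelling this finite amount in the
      modular law leaves only the new error \<open>d (Suc n)\<close> on top of the old ones.\<close>
    have sub: "E n \<subseteq> (\<Union>w\<in>meet_nodes (T n) (S (Suc n)). cyl w)"
      using T_cover[of n] order_trans[OF incseq_SucD[OF E] S(1)]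
      by (intro order_trans[OF _ meet_nodes_cover] Int_greatest)
    have "net_content q (E n) + ?W (T (Suc n)) \<le> ?W (meet_nodes (T n) (S (Suc n))) + ?W (T (Suc n))"
      by (intro add_right_mono net_content_le sub)
    also have "\<dots> = ?W (T n) + ?W (S (Suc n))"
    proof -
      have "minimal_nodes (T n) = T n" by (simp add: T_def minimal_nodes_idem)
      from emeasure_node_weight_join_meet[OF this S(3)[of "Suc n"], of q] show ?thesis
        by (simp only: T_Suc add.commute)
    qed
    also have "\<dots> \<le> (net_content q (E n) + ennreal (\<Sum>i\<le>n. d i)) + (net_content q (E (Suc n)) + d (Suc n))"
      by (intro add_mono Suc S)
    also have "\<dots> = net_content q (E n) + (net_content q (E (Suc n)) + ennreal (\<Sum>i\<le>Suc n. d i))"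
      using d by (simp add: ac_simps ennreal_plus sum_nonneg less_imp_le)
    finally show ?case
      using net_content_finite[of q "E n"] by (auto simp: ennreal_add_left_cancel_le)
  qed
  have sum_d: "(\<Sum>i\<le>n. d i) \<le> e" for n
  proof -
    have "(\<Sum>i\<le>n. d i) = e * (1 - (1 / 2) ^ Suc n)"
      by (induction n) (auto simp: d_def algebra_simps)
    also have "\<dots> \<le> e * 1" using e by (intro mult_left_mono) auto
    finally show ?thesis by simp
  qed
  \<comment> \<open>A word of \<open>R\<close> that occurs in some \<open>S i\<close> with
    \<open>i \<le> n\<close> is minimal also in the n-th stage, so \<open>H n\<close> lies in
    \<open>T n\<close>. Thus \<open>R\<close> is an increasing union of sets with controlled
    weight.\<close>
  define R where "R = minimal_nodes (\<Union>n. S n)"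
  define H where "H n = R \<inter> (\<Union>i\<le>n. S i)" for n
  have H: "H n \<subseteq> T n" for n
    by (auto simp: H_def R_def T_def minimal_nodes_def)
  have "net_content q (\<Union>n. E n) \<le> ?W R"
    using S(1) unfolding R_def by (intro net_content_le) (subst minimal_nodes_cover, fastforce)
  also have "R = (\<Union>n. H n)"
    by (auto simp: H_def R_def minimal_nodes_def)
  also have "?W (\<Union>n. H n) = (SUP n. ?W (H n))"
    by (intro SUP_emeasure_incseq[symmetric]) (auto simp: H_def incseq_def intro: order_trans)
  also have "\<dots> \<le> (SUP n. net_content q (E n)) + ennreal e"
  proof (rule SUP_least)
    fix n
    have "?W (H n) \<le> ?W (T n)" by (intro emeasure_node_weight_mono H)
    also have "\<dots> \<le> net_content q (E n) + ennreal (\<Sum>i\<le>n. d i)" by (rule W_T)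
    also have "\<dots> \<le> (SUP n. net_content q (E n)) + ennreal e"
      by (intro add_mono SUP_upper ennreal_leI sum_d) auto
    finally show "?W (H n) \<le> (SUP n. net_content q (E n)) + ennreal e" .
  qed
  finally show "net_content q (\<Union>n. E n) \<le> (SUP n. net_content q (E n)) + ennreal e" .
qed

section \<open>Compactness and capacitability\<close>

lemma tendsto_funI:
  fixes f :: "'a \<Rightarrow> 'i \<Rightarrow> 'b::topological_space"
  assumes "\<And>i. ((\<lambda>k. f k i) \<longlongrightarrow> l i) F"
  shows "(f \<longlongrightarrow> l) F"
  using limitin_componentwise[of "\<lambda>_. euclidean" UNIV f l F] assms
  by (simp add: euclidean_product_topology)

lemma compact_box: "compact {x :: nat \<Rightarrow> nat. \<forall>i. x i \<le> m i}"
proof -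
  have "compactin (product_topology (\<lambda>i :: nat. euclidean :: nat topology) UNIV) (PiE UNIV (\<lambda>i. {..m i}))"
    unfolding compactin_PiE by (simp add: finite_imp_compact)
  moreover have "PiE UNIV (\<lambda>i. {..m i}) = {x. \<forall>i. x i \<le> m i}" by auto
  ultimately show ?thesis by (simp add: euclidean_product_topology)
qed

text \<open>Choquet's argument: the entries of the witness sequence are bounded one after the other,
  each time keeping the content above \<open>c\<close> by continuity along increasing sets. The
  stages \<open>D m k\<close> need not be compact, but the projection \<open>K\<close> of the fully
  bounded witnesses is, and a cylinder cover of \<open>K\<close> already covers some stage.\<close>

lemma net_content_capacitable:
  fixes C :: "((nat \<Rightarrow> nat) \<times> (nat \<Rightarrow> nat)) set"
  assumes C: "closed C" and b: "\<And>s x i. (s, x) \<in> C \<Longrightarrow> x i < b" and c: "c < net_content q (snd ` C)"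
  obtains K where "compact K" "K \<subseteq> snd ` C" "c \<le> net_content q K"
proof -
  define D where "D m k = snd ` {p \<in> C. \<forall>i<k. fst p i \<le> m i}" for m :: "nat \<Rightarrow> nat" and k
  define V where "V w = snd ` {p \<in> C. \<forall>i<length w. fst p i \<le> w ! i}" for w
  have D_V: "D m k = V (map m [0..<k])" for m k by (simp add: D_def V_def)
  have step: "\<exists>j. c < net_content q (V (w @ [j]))" if w: "c < net_content q (V w)" for w
  proof -
    have *: "(\<forall>i<length (w @ [j]). f i \<le> (w @ [j]) ! i)
        \<longleftrightarrow> (\<forall>i<length w. f i \<le> w ! i) \<and> f (length w) \<le> j" for f :: "nat \<Rightarrow> nat" and j
      by (auto simp: nth_append less_Suc_eq)
    have "V w = (\<Union>j. V (w @ [j]))"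
      unfolding V_def * by blast
    moreover have "incseq (\<lambda>j. V (w @ [j]))"
      unfolding incseq_def V_def * by (blast intro: order_trans)
    ultimately have "c < (SUP j. net_content q (V (w @ [j])))"
      using net_content_incseq[of "\<lambda>j. V (w @ [j])" q] w by simp
    then show ?thesis by (simp add: less_SUP_iff)
  qed
  define W where "W = rec_nat [] (\<lambda>_ w. w @ [SOME j. c < net_content q (V (w @ [j]))])"
  have W_0: "W 0 = []" and W_Suc: "W (Suc k) = W k @ [SOME j. c < net_content q (V (W k @ [j]))]" for k
    by (simp_all add: W_def)
  have W: "c < net_content q (V (W k))" for k
  proof (induction k)
    case 0
    then show ?case using c by (simp add: W_0 V_def)
  next
    case (Suc k)
    from someI_ex[OF step[OF this]] show ?case by (simp add: W_Suc)
  qed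
  define m where "m k = (SOME j. c < net_content q (V (W k @ [j])))" for k
  have W_m: "W k = map m [0..<k]" for k
    by (induction k) (simp_all add: W_0 W_Suc m_def)
  have D: "c < net_content q (D m k)" for k
    using W[of k] by (simp add: D_V W_m)
  define B where "B = {x :: nat \<Rightarrow> nat. \<forall>i. x i \<le> m i} \<times> {x :: nat \<Rightarrow> nat. \<forall>i. x i \<le> b}"
  have B: "compact B" unfolding B_def by (intro compact_Times compact_box)
  define K where "K = snd ` (B \<inter> C)"
  have "compact K"
    unfolding K_def
    by (intro compact_continuous_image continuous_intros) (use B C in auto)
  moreover have "K \<subseteq> snd ` C" by (auto simp: K_def)
  moreover have "c \<le> net_content q K"
    unfolding net_content_def
  proof (rule INF_greatest, clarify)
    fix S assume S: "K \<subseteq> (\<Union>w\<in>S. cyl w)"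
    have "\<exists>k. D m k \<subseteq> (\<Union>w\<in>S. cyl w)"
    proof (rule ccontr)
      assume "\<nexists>k. D m k \<subseteq> (\<Union>w\<in>S. cyl w)"
      then have "\<forall>k. \<exists>p. p \<in> C \<and> (\<forall>i<k. fst p i \<le> m i) \<and> snd p \<notin> (\<Union>w\<in>S. cyl w)"
        unfolding D_def by blast
      then obtain p where p: "\<And>k. p k \<in> C" "\<And>k i. i < k \<Longrightarrow> fst (p k) i \<le> m i"
        "\<And>k. snd (p k) \<notin> (\<Union>w\<in>S. cyl w)"
        by metis
      \<comment> \<open>Truncation at \<open>m\<close> moves the witnesses into the compact box and
        leaves the first \<open>k\<close> entries alone. Hence along a convergent subsequence the
        untruncated witnesses have the same limit, which lies in \<open>C\<close> by
        closedness.\<close>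
      define r where "r k = ((\<lambda>i. min (fst (p k) i) (m i)), snd (p k))" for k
      have "r k \<in> B" for k
        using b[of "fst (p k)" "snd (p k)"] p(1)[of k] by (auto simp: r_def B_def intro: less_imp_le)
      then obtain l h where l: "l \<in> B" "strict_mono h" "(r \<circ> h) \<longlonglongrightarrow> l"
        using seq_compactE[OF compact_imp_seq_compact[OF B], of r] by metis
      have r1: "(\<lambda>k. fst (r (h k))) \<longlonglongrightarrow> fst l" and r2: "(\<lambda>k. snd (r (h k))) \<longlonglongrightarrow> snd l"
        using tendsto_fst[OF l(3)] tendsto_snd[OF l(3)] by (simp_all add: o_def)
      have p1: "(\<lambda>k. fst (p (h k))) \<longlonglongrightarrow> fst l"
      proof (rule tendsto_funI)
        fix i
        have "(\<lambda>k. fst (r (h k)) i) \<longlonglongrightarrow> fst l i"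
          using continuous_on_tendsto_compose[OF continuous_on_product_coordinates r1] by simp
        moreover have "\<forall>\<^sub>F k in sequentially. fst (r (h k)) i = fst (p (h k)) i"
          using eventually_gt_at_top[of i]
        proof eventually_elim
          case (elim k)
          then have "i < h k" using seq_suble[OF l(2), of k] by simp
          then show ?case using p(2)[of i "h k"] by (simp add: r_def)
        qed
        ultimately show "(\<lambda>k. fst (p (h k)) i) \<longlonglongrightarrow> fst l i"
          by (rule Lim_transform_eventually)
      qed
      have "(\<lambda>k. (fst (p (h k)), snd (p (h k)))) \<longlonglongrightarrow> (fst l, snd l)"
        using p1 r2 by (intro tendsto_Pair) (auto simp: r_def)
      then have "l \<in> C"
        using closed_sequentially[OF C, of "\<lambda>k. p (h k)" l] p(1) by simp
      then have "snd l \<in> (\<Union>w\<in>S. cyl w)" using S l(1) by (auto simp: K_def)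
      moreover have "open (\<Union>w\<in>S. cyl w)" by (auto intro: open_cyl)
      ultimately have "\<forall>\<^sub>F k in sequentially. snd (r (h k)) \<in> (\<Union>w\<in>S. cyl w)"
        using topological_tendstoD[OF r2] by blast
      then have "\<forall>\<^sub>F k :: nat in sequentially. False"
        by eventually_elim (use p(3) in \<open>auto simp: r_def\<close>)
      then show False by simp
    qed
    then obtain k where "D m k \<subseteq> (\<Union>w\<in>S. cyl w)" ..
    then have "net_content q (D m k) \<le> emeasure (node_weight q) S" by (rule net_content_le)
    then show "c \<le> emeasure (node_weight q) S" using D[of k] by simp
  qed
  ultimately show ?thesis using that by blast
qed

section \<open>Measures from flows on a tree\<close>

abbreviation seq_algebra :: "(nat \<Rightarrow> nat) measure" where
  "seq_algebra \<equiv> PiM UNIV (\<lambda>_. count_space UNIV)"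

lemma cyl_in_sets: "cyl w \<in> sets seq_algebra"
proof -
  have "cyl w = {x \<in> space seq_algebra. \<forall>i\<in>{..<length w}. x i = w ! i}"
    by (auto simp: cyl_def space_PiM)
  also have "\<dots> \<in> sets seq_algebra"
    by measurable
  finally show ?thesis .
qed

text \<open>A flow on the tree is realised by nested half-open subintervals of \<open>{0..<f []}\<close> of length
  \<open>f w\<close>; the measure is the image of Lebesgue measure under the map from a point to its path.\<close>

lemma tree_flow_measure:
  fixes f :: "nat list \<Rightarrow> real"
  assumes f: "\<And>w. 0 \<le> f w" and split: "\<And>w. f w = (\<Sum>i<b. f (w @ [i]))"
  obtains M where "sets M = sets seq_algebra" "emeasure M UNIV = ennreal (f [])"
    "\<And>w. emeasure M (cyl w) \<le> ennreal (f w)"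
proof -
  \<comment> \<open>The left end of the interval of \<open>w\<close>: the total flow into the
    smaller siblings met along \<open>w\<close>.\<close>
  define L where "L w = (\<Sum>k<length w. \<Sum>j<w ! k. f (take k w @ [j]))" for w
  have L_Nil: "L [] = 0" by (simp add: L_def)
  have L_snoc: "L (w @ [i]) = L w + (\<Sum>j<i. f (w @ [j]))" for w i
    by (simp add: L_def nth_append)
  \<comment> \<open>For \<open>u\<close> to the right of the interval of \<open>w\<close> no index
    need qualify and the value is unspecified; by \<open>inv\<close> this never happens along the
    path of a point of \<open>{0..<f []}\<close>.\<close>
  define next_letter where "next_letter u w = (LEAST i. u < L w + (\<Sum>j<Suc i. f (w @ [j])))" for u w
  define W where "W u = rec_nat [] (\<lambda>_ w. w @ [next_letter u w])" for u
  have W_0: "W u 0 = []" and W_Suc: "W u (Suc n) = W u n @ [next_letter u (W u n)]" for u n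
    by (simp_all add: W_def)
  define path where "path u n = next_letter u (W u n)" for u n
  have W_path: "W u n = map (path u) [0..<n]" for u n
    by (induction n) (simp_all add: W_0 W_Suc path_def)
  have inv: "L (W u n) \<le> u \<and> u < L (W u n) + f (W u n)" if u: "0 \<le> u" "u < f []" for u n
  proof (induction n)
    case 0
    then show ?case using u by (simp add: W_0 L_Nil)
  next
    case (Suc n)
    define w where "w = W u n"
    define i where "i = next_letter u w"
    have w: "L w \<le> u" "u < L w + f w" using Suc by (auto simp: w_def)
    have "b \<noteq> 0" using w split[of w] by (cases b) auto
    then have "u < L w + (\<Sum>j<Suc (b - 1). f (w @ [j]))" using w(2) split[of w] by simp
    then have i1: "u < L w + (\<Sum>j<Suc i. f (w @ [j]))"
      unfolding i_def next_letter_def by (rule LeastI)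
    have i2: "L w + (\<Sum>j<i. f (w @ [j])) \<le> u"
    proof (cases i)
      case 0
      then show ?thesis using w by simp
    next
      case (Suc k)
      then have "\<not> u < L w + (\<Sum>j<Suc k. f (w @ [j]))"
        unfolding i_def next_letter_def by (intro not_less_Least) simp
      then show ?thesis using Suc by simp
    qed
    show ?case
      using i1 i2 by (simp add: W_Suc L_snoc add.assoc flip: w_def i_def)
  qed
  have next_meas: "(\<lambda>u. next_letter u w) \<in> borel \<rightarrow>\<^sub>M count_space UNIV" for w
    unfolding next_letter_def by measurable
  have W_meas: "(\<lambda>u. W u n) \<in> borel \<rightarrow>\<^sub>M count_space UNIV" for n
  proof (induction n)
    case (Suc n)
    have "(\<lambda>u. (\<lambda>w u. w @ [next_letter u w]) (W u n) u) \<in> borel \<rightarrow>\<^sub>M count_space UNIV"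
    proof (rule measurable_compose_countable[OF _ Suc])
      fix w
      show "(\<lambda>u. w @ [next_letter u w]) \<in> borel \<rightarrow>\<^sub>M count_space UNIV"
        by (rule measurable_compose[OF next_meas]) simp
    qed
    then show ?case by (simp add: W_Suc)
  qed (simp add: W_0)
  have path_meas: "path \<in> borel \<rightarrow>\<^sub>M seq_algebra"
  proof (rule measurable_PiM_single')
    fix n
    have "path = (\<lambda>u n. W u (Suc n) ! n)"
      by (simp add: W_path fun_eq_iff del: upt_Suc)
    then show "(\<lambda>u. path u n) \<in> borel \<rightarrow>\<^sub>M count_space UNIV"
      using measurable_compose[OF W_meas[of "Suc n"], of "\<lambda>w. w ! n" "count_space UNIV"] by simp
  qed auto
  define N where "N = restrict_space lborel {0..<f []}"
  have path_N: "path \<in> N \<rightarrow>\<^sub>M seq_algebra"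
    unfolding N_def by (intro measurable_restrict_space1) (use path_meas in simp)
  define M where "M = distr N seq_algebra path"
  have em: "emeasure M A = emeasure lborel (path -` A \<inter> {0..<f []})" if "A \<in> sets seq_algebra" for A
    using that path_N
    by (simp add: M_def emeasure_distr) (simp add: N_def emeasure_restrict_space space_restrict_space)
  show ?thesis
  proof
    show "sets M = sets seq_algebra" by (simp add: M_def)
    have "UNIV \<in> sets seq_algebra"
      using cyl_in_sets[of "[]"] by simp
    then show "emeasure M UNIV = ennreal (f [])"
      using f by (simp add: em)
  next
    fix w
    have "path -` cyl w \<inter> {0..<f []} \<subseteq> {L w..<L w + f w}"
    proof
      fix u assume u: "u \<in> path -` cyl w \<inter> {0..<f []}"
      then have "W u (length w) = w"
        by (auto simp: W_path cyl_def intro!: nth_equalityI)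
      then show "u \<in> {L w..<L w + f w}" using inv[of u "length w"] u by simp
    qed
    then have "emeasure M (cyl w) \<le> emeasure lborel {L w..<L w + f w}"
      unfolding em[OF cyl_in_sets] by (intro emeasure_mono) auto
    then show "emeasure M (cyl w) \<le> ennreal (f w)"
      using f by simp
  qed
qed

text \<open>The mass of each word is divided among its children in proportion to their contents. By
  subadditivity the contents of the children add up to at least that of the parent, so a flow that
  equals the content at the root stays below it everywhere.\<close>

lemma net_content_measure:
  assumes K: "closed K" "K \<subseteq> {x. \<forall>i. x i < b}" and q: "0 \<le> q"
  obtains M where "sets M = sets seq_algebra" "emeasure M UNIV = net_content q K"
    "\<And>w. emeasure M (cyl w) \<le> ennreal (q ^ length w)" "- K \<in> null_sets M"
proof -
  define g where "g w = enn2real (net_content q (K \<inter> cyl w))" for w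
  have g: "ennreal (g w) = net_content q (K \<inter> cyl w)" for w
    using net_content_finite by (simp add: g_def)
  have g0: "0 \<le> g w" for w by (simp add: g_def)
  have g_split: "g w \<le> (\<Sum>i<b. g (w @ [i]))" for w
  proof -
    have "K \<inter> cyl w = (\<Union>i<b. K \<inter> cyl (w @ [i]))"
      using K(2) by (auto simp: cyl_snoc)
    then have "ennreal (g w) \<le> (\<Sum>i<b. ennreal (g (w @ [i])))"
      using net_content_UN_finite[of "{..<b}" q "\<lambda>i. K \<inter> cyl (w @ [i])"] by (simp only: g finite_lessThan)
    also have "\<dots> = ennreal (\<Sum>i<b. g (w @ [i]))" using g0 by simp
    finally show ?thesis by (simp add: ennreal_le_iff sum_nonneg g0)
  qed
  define f where "f w = g [] * (\<Prod>k<length w. g (take (Suc k) w) / (\<Sum>j<b. g (take k w @ [j])))" for w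
  have f_snoc: "f (w @ [i]) = f w * (g (w @ [i]) / (\<Sum>j<b. g (w @ [j])))" for w i
    by (simp add: f_def)
  have f_le: "0 \<le> f w \<and> f w \<le> g w" for w
  proof (induction w rule: rev_induct)
    case Nil
    then show ?case by (simp add: f_def g0)
  next
    case (snoc i w)
    let ?s = "\<Sum>j<b. g (w @ [j])"
    have s: "f w \<le> ?s" "0 \<le> ?s" using snoc g_split[of w] g0 by (auto intro: sum_nonneg)
    have "f w / ?s \<le> 1" using s by (auto simp: divide_le_eq_1)
    then have "f w / ?s * g (w @ [i]) \<le> g (w @ [i])"
      using g0 by (intro mult_left_le_one_le) (use snoc s in auto)
    then show ?case using snoc s g0[of "w @ [i]"] by (simp add: f_snoc mult.commute)
  qed
  \<comment> \<open>If all children have content zero, the quotients are 0 by the convention for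
    division; the identity survives because then \<open>f w \<le> g w \<le> 0\<close>.\<close>
  have f_split: "f w = (\<Sum>i<b. f (w @ [i]))" for w
  proof (cases "(\<Sum>j<b. g (w @ [j])) = 0")
    case True
    then have "f w = 0" using f_le[of w] g_split[of w] by simp
    then show ?thesis by (simp add: f_snoc)
  next
    case False
    then show ?thesis by (simp add: f_snoc flip: sum_distrib_left sum_divide_distrib)
  qed
  obtain M where M: "sets M = sets seq_algebra" "emeasure M UNIV = ennreal (f [])"
    "\<And>w. emeasure M (cyl w) \<le> ennreal (f w)"
    using tree_flow_measure[of f b] f_le f_split by blast
  have M_g: "emeasure M (cyl w) \<le> net_content q (K \<inter> cyl w)" for w
    using M(3)[of w] f_le[of w] by (metis g ennreal_leI order_trans)
  show ?thesis
  proof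
    show "sets M = sets seq_algebra" by (rule M)
    show "emeasure M UNIV = net_content q K" using M(2) g[of "[]"] by (simp add: f_def)
    show "emeasure M (cyl w) \<le> ennreal (q ^ length w)" for w
      by (rule order_trans[OF M_g net_content_le_power]) simp
    \<comment> \<open>A point outside the closed set \<open>K\<close> has a cylinder missing
      \<open>K\<close>. There are only countably many cylinders, and those missing \<open>K\<close>
      are null because their trace on \<open>K\<close> has content 0.\<close>
    have "- K \<subseteq> (\<Union>w\<in>{w. K \<inter> cyl w = {}}. cyl w)"
    proof
      fix x assume x: "x \<in> - K"
      have "\<exists>n. K \<inter> cyl (map x [0..<n]) = {}"
      proof (rule ccontr)
        assume "\<nexists>n. K \<inter> cyl (map x [0..<n]) = {}"
        then have "\<forall>n. \<exists>y. y \<in> K \<and> y \<in> cyl (map x [0..<n])" by blast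
        then obtain y where y: "\<And>n. y n \<in> K" "\<And>n. y n \<in> cyl (map x [0..<n])" by metis
        have "y \<longlonglongrightarrow> x"
        proof (rule tendsto_funI)
          fix i
          have "\<forall>\<^sub>F n in sequentially. y n i = x i"
            using eventually_gt_at_top[of i]
          proof eventually_elim
            case (elim n)
            then show ?case using y(2)[of n] by (auto simp: cyl_def)
          qed
          then show "(\<lambda>n. y n i) \<longlonglongrightarrow> x i" by (rule tendsto_eventually)
        qed
        then show False using closed_sequentially[OF K(1), of y x] y(1) x by blast
      qed
      then show "x \<in> (\<Union>w\<in>{w. K \<inter> cyl w = {}}. cyl w)" using map_in_cyl by blast
    qed
    moreover have "(\<Union>w\<in>{w. K \<inter> cyl w = {}}. cyl w) \<subseteq> - K" by blast
    ultimately have "- K = (\<Union>w\<in>{w. K \<inter> cyl w = {}}. cyl w)" by blast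
    moreover have "cyl w \<in> null_sets M" if "K \<inter> cyl w = {}" for w
      using M_g[of w] that cyl_in_sets M(1) by (auto simp: null_sets_def)
    ultimately show "- K \<in> null_sets M" by (auto intro: null_sets_UN')
  qed
qed

section \<open>Null sets of Hausdorff measures\<close>

lemma hausdorff_measure_eq_0D:
  assumes "hausdorff_measure m s E = 0" "0 < \<delta>" "0 < \<epsilon>"
  obtains U :: "nat \<Rightarrow> 'a set" where "E \<subseteq> (\<Union>i. U i)" "\<And>i. U i \<subseteq> mspace m"
    "\<And>i. ediameter m (U i) \<le> ennreal \<delta>" "(\<Sum>i. diam_powr m s (U i)) < \<epsilon>"
proof -
  have "hausdorff_premeasure m s \<delta> E \<le> hausdorff_measure m s E"
    unfolding hausdorff_measure_def by (rule SUP_upper) (use assms in simp)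
  then have "hausdorff_premeasure m s \<delta> E < \<epsilon>" using assms by simp
  then show ?thesis
    unfolding hausdorff_premeasure_def INF_less_iff using that by blast
qed

text \<open>For positive \<open>s\<close> a small total forces every single term below
  \<open>\<delta> powr s\<close>, hence every diameter below \<open>\<delta>\<close>. Contents at
  unrestricted scale thus detect null sets.\<close>

lemma hausdorff_measure_eq_0I:
  fixes m :: "'a metric"
  assumes s: "0 < s" and U: "\<And>\<epsilon>. 0 < \<epsilon> \<Longrightarrow> \<exists>U :: nat \<Rightarrow> 'a set. E \<subseteq> (\<Union>i. U i) \<and>
    (\<forall>i. U i \<subseteq> mspace m \<and> ediameter m (U i) < top) \<and> (\<Sum>i. diam_powr m s (U i)) < \<epsilon>"
  shows "hausdorff_measure m s E = 0"
proof -
  have "hausdorff_premeasure m s \<delta> E = 0" if \<delta>: "0 < \<delta>" for \<delta>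
  proof -
    have "hausdorff_premeasure m s \<delta> E \<le> 0 + ennreal e" if "0 < e" for e
    proof -
      have "0 < min (ennreal e) (ennreal (\<delta> powr s))" using \<open>0 < e\<close> \<delta> by simp
      from U[OF this] obtain U where U: "E \<subseteq> (\<Union>i. U i)" "\<And>i. U i \<subseteq> mspace m"
        "\<And>i. ediameter m (U i) < top" "(\<Sum>i. diam_powr m s (U i)) < ennreal e"
        "(\<Sum>i. diam_powr m s (U i)) < ennreal (\<delta> powr s)"
        by auto
      have "ediameter m (U i) \<le> ennreal \<delta>" for i
      proof (cases "U i = {}")
        case True
        then show ?thesis by (simp add: ediameter_def bot_ennreal)
      next
        case False
        obtain d where d: "ediameter m (U i) = ennreal d" "0 \<le> d"
          using U(3)[of i] by (metis ennreal_cases less_irrefl)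
        have "diam_powr m s (U i) = ennreal (d powr s)"
          using False s d by (simp add: diam_powr_def)
        moreover have "diam_powr m s (U i) \<le> (\<Sum>i. diam_powr m s (U i))"
          using sum_le_suminf[of "\<lambda>i. diam_powr m s (U i)" "{i}"] by simp
        ultimately have "ennreal (d powr s) < ennreal (\<delta> powr s)" using U(5) by simp
        then have "d powr s < \<delta> powr s" by (simp add: ennreal_less_iff)
        then have "d < \<delta>" using s d(2) \<delta> by (meson not_less powr_mono2 less_imp_le)
        then show ?thesis by (simp add: d ennreal_leI)
      qed
      then have "hausdorff_premeasure m s \<delta> E \<le> (\<Sum>i. diam_powr m s (U i))"
        unfolding hausdorff_premeasure_def using U by (intro INF_lower) auto
      then show ?thesis using U(4) by simp
    qed
    then have "hausdorff_premeasure m s \<delta> E \<le> 0"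
      using ennreal_le_epsilon[of 0 "hausdorff_premeasure m s \<delta> E"] by blast
    then show ?thesis by simp
  qed
  then show ?thesis by (simp add: hausdorff_measure_def)
qed

lemma diam_powr_antimono:
  assumes "0 \<le> s" "s \<le> s'" "ediameter m U \<le> 1"
  shows "diam_powr m s' U \<le> diam_powr m s U"
proof -
  have "enn2real (ediameter m U) \<le> 1"
    using enn2real_mono[OF assms(3)] by simp
  then have "enn2real (ediameter m U) powr s' \<le> enn2real (ediameter m U) powr s" if "s \<noteq> 0"
    using that assms by (intro powr_mono') auto
  moreover have "enn2real (ediameter m U) powr s' \<le> 1"
    using \<open>enn2real (ediameter m U) \<le> 1\<close> assms by (simp add: powr_le1)
  ultimately show ?thesis using assms by (auto simp: diam_powr_def ennreal_leI)
qed

lemma hausdorff_measure_eq_0_mono: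
  assumes "hausdorff_measure m s E = 0" "0 \<le> s" "s \<le> s'"
  shows "hausdorff_measure m s' E = 0"
proof (cases "s' = 0")
  case False
  show ?thesis
  proof (rule hausdorff_measure_eq_0I)
    fix \<epsilon> :: ennreal assume "0 < \<epsilon>"
    obtain U where U: "E \<subseteq> (\<Union>i. U i)" "\<And>i. U i \<subseteq> mspace m"
      "\<And>i. ediameter m (U i) \<le> ennreal 1" "(\<Sum>i. diam_powr m s (U i)) < \<epsilon>"
      using hausdorff_measure_eq_0D[OF assms(1) zero_less_one \<open>0 < \<epsilon>\<close>] by blast
    have "(\<Sum>i. diam_powr m s' (U i)) \<le> (\<Sum>i. diam_powr m s (U i))"
      using U(3) assms by (intro suminf_le diam_powr_antimono) auto
    moreover have "ediameter m (U i) < top" for i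
      using U(3)[of i] by (metis ennreal_less_top le_less_trans)
    ultimately show "\<exists>U. E \<subseteq> (\<Union>i. U i) \<and> (\<forall>i. U i \<subseteq> mspace m \<and> ediameter m (U i) < top) \<and>
        (\<Sum>i. diam_powr m s' (U i)) < \<epsilon>"
      using U by (intro exI[of _ U]) auto
  qed (use False assms in auto)
qed (use assms in auto)

lemma hausdorff_measure_eq_0_UN:
  fixes E :: "nat \<Rightarrow> 'a set"
  assumes "0 < s" "\<And>n. hausdorff_measure m s (E n) = 0"
  shows "hausdorff_measure m s (\<Union>n. E n) = 0"
proof (rule hausdorff_measure_eq_0I[OF assms(1)])
  fix \<epsilon> :: ennreal assume "0 < \<epsilon>"
  then obtain e :: real where e: "0 < e" "ennreal e < \<epsilon>"
    by (metis ennreal_cases ennreal_less_zero_iff dense ennreal_0 less_irrefl not_less_zero order_less_le top.not_eq_extremum less_trans ennreal_less_top)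
  define d where "d n = e * (1 / 2) ^ Suc n" for n
  have d: "0 < d n" for n using e by (simp add: d_def)
  have "\<exists>U. E n \<subseteq> (\<Union>i. U i) \<and> (\<forall>i. U i \<subseteq> mspace m) \<and>
      (\<forall>i. ediameter m (U i) \<le> ennreal 1) \<and> (\<Sum>i. diam_powr m s (U i)) < ennreal (d n)" for n
    by (rule hausdorff_measure_eq_0D[OF assms(2)[of n] zero_less_one, of "ennreal (d n)"]) (use d in auto)
  then obtain U where U: "\<And>n. E n \<subseteq> (\<Union>i. U n i)" "\<And>n i. U n i \<subseteq> mspace m"
    "\<And>n i. ediameter m (U n i) \<le> ennreal 1" "\<And>n. (\<Sum>i. diam_powr m s (U n i)) < ennreal (d n)"
    by metis
  define V where "V k = case_prod U (prod_decode k)" for k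
  have "(\<Union>n. E n) \<subseteq> (\<Union>k. V k)"
  proof
    fix x assume "x \<in> (\<Union>n. E n)"
    then obtain n i where "x \<in> U n i" using U(1) by blast
    then have "x \<in> V (prod_encode (n, i))" by (simp add: V_def)
    then show "x \<in> (\<Union>k. V k)" by blast
  qed
  moreover have "V k \<subseteq> mspace m \<and> ediameter m (V k) < top" for k
    using U(2) le_less_trans[OF U(3) ennreal_less_top] by (simp add: V_def split: prod.split)
  moreover have "(\<Sum>k. diam_powr m s (V k)) < \<epsilon>"
  proof -
    have "(\<Sum>k. diam_powr m s (V k)) = (\<Sum>n. \<Sum>i. diam_powr m s (U n i))"
      using suminf_ennreal_2dimen[of "\<lambda>n. \<Sum>i. diam_powr m s (U n i)" "\<lambda>p. diam_powr m s (case_prod U p)"]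
      by (simp add: V_def)
    also have "\<dots> \<le> (\<Sum>n. ennreal (d n))"
      using U(4) by (intro suminf_le) (auto intro: less_imp_le)
    also have "\<dots> = ennreal e"
    proof (rule suminf_ennreal_eq)
      show "d sums e"
        using sums_mult[OF power_half_series, of e] by (simp only: d_def[abs_def] mult_1_right)
    qed (use d less_imp_le in auto)
    finally show ?thesis using e by simp
  qed
  ultimately show "\<exists>V. (\<Union>n. E n) \<subseteq> (\<Union>i. V i) \<and> (\<forall>i. V i \<subseteq> mspace m \<and> ediameter m (V i) < top) \<and>
      (\<Sum>i. diam_powr m s (V i)) < \<epsilon>"
    by blast
qed

lemma hausdorff_measure_mono: "E \<subseteq> F \<Longrightarrow> hausdorff_measure m s E \<le> hausdorff_measure m s F"
  unfolding hausdorff_measure_def hausdorff_premeasure_def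
  by (intro SUP_subset_mono INF_superset_mono) auto

lemma hausdorff_measure_eq_0_Un:
  assumes "0 < s" "hausdorff_measure m s E = 0" "hausdorff_measure m s F = 0"
  shows "hausdorff_measure m s (E \<union> F) = 0"
proof -
  have "hausdorff_measure m s (\<Union>n :: nat. if n = 0 then E else F) = 0"
    using assms by (intro hausdorff_measure_eq_0_UN) auto
  moreover have "E \<union> F \<subseteq> (\<Union>n :: nat. if n = 0 then E else F)"
    by (auto split: if_splits intro: exI[of _ 0] exI[of _ 1])
  ultimately show ?thesis using hausdorff_measure_mono by (metis le_zero_eq)
qed

lemma hausdorff_measure_neq_0:
  assumes "ennreal s < hausdorff_dim m E" "0 \<le> s"
  shows "hausdorff_measure m s E \<noteq> 0"
proof
  assume "hausdorff_measure m s E = 0"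
  then have "hausdorff_dim m E \<le> ennreal s"
    unfolding hausdorff_dim_def using assms(2) by (intro INF_lower) auto
  then show False using assms(1) by simp
qed

lemma hausdorff_measure_eq_0:
  assumes "hausdorff_dim m E < ennreal s"
  shows "hausdorff_measure m s E = 0"
proof -
  obtain s0 where s0: "0 \<le> s0" "hausdorff_measure m s0 E = 0" "ennreal s0 < ennreal s"
    using assms unfolding hausdorff_dim_def INF_less_iff by auto
  then show ?thesis
    using hausdorff_measure_eq_0_mono[OF s0(2,1), of s] by (simp add: ennreal_less_iff)
qed

section \<open>Dyadic coding of the unit square\<close>

text \<open>Words over the letters 0 to 3 code dyadic squares: the lower bit of a letter belongs to
  the first coordinate, the upper bit to the second. Larger letters are read modulo 4 instead of
  being excluded, so the coding map is defined and continuous on all sequences.\<close>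

definition letter_digit :: "2 \<Rightarrow> nat \<Rightarrow> nat" where
  "letter_digit j a = (if j = 1 then a mod 2 else a div 2 mod 2)"

definition word_value :: "2 \<Rightarrow> nat list \<Rightarrow> nat" where
  "word_value j = foldl (\<lambda>s a. 2 * s + letter_digit j a) 0"

definition dyadic_coord :: "2 \<Rightarrow> (nat \<Rightarrow> nat) \<Rightarrow> real" where
  "dyadic_coord j x = (\<Sum>k. real (letter_digit j (x k)) * (1 / 2) ^ Suc k)"

definition dyadic_point :: "(nat \<Rightarrow> nat) \<Rightarrow> real ^ 2" where
  "dyadic_point x = dyadic_coord 1 x *\<^sub>R axis 1 1 + dyadic_coord 2 x *\<^sub>R axis 2 1"

lemma dyadic_point_nth [simp]: "dyadic_point x $ j = dyadic_coord j x"
  using exhaust_2[of j] by (auto simp: dyadic_point_def axis_def)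

lemma letter_digit_le_1: "letter_digit j a \<le> 1"
  using mod_less_divisor[of 2] by (auto simp: letter_digit_def less_Suc_eq_le numeral_2_eq_2)

lemma word_value_Nil [simp]: "word_value j [] = 0"
  by (simp add: word_value_def)

lemma word_value_snoc [simp]: "word_value j (w @ [a]) = 2 * word_value j w + letter_digit j a"
  by (simp add: word_value_def)

lemma word_value_inject:
  assumes "length v = length w" "\<forall>a\<in>set v. a < 4" "\<forall>a\<in>set w. a < 4"
    and "\<And>j. word_value j v = word_value j w"
  shows "v = w"
  using assms
proof (induction v arbitrary: w rule: rev_induct)
  case (snoc a v)
  then obtain b w' where w: "w = w' @ [b]" by (metis length_0_conv rev_exhaust snoc_eq_iff_butlast)
  have eq: "2 * word_value j v + letter_digit j a = 2 * word_value j w' + letter_digit j b" for j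
    using snoc.prems(4)[of j] by (simp add: w)
  have *: "word_value j v = word_value j w' \<and> letter_digit j a = letter_digit j b" for j
    using eq[of j] letter_digit_le_1[of j a] letter_digit_le_1[of j b] by presburger
  have "a mod 2 = b mod 2" "a div 2 mod 2 = b div 2 mod 2"
    using *[of 1] *[of 2] by (simp_all add: letter_digit_def)
  moreover have "a < 4" "b < 4" using snoc.prems by (auto simp: w)
  ultimately have "a = b"
    using mod_mult2_eq[of a 2 2] mod_mult2_eq[of b 2 2] by simp
  moreover have "v = w'" using snoc.prems * by (intro snoc.IH) (auto simp: w)
  ultimately show ?case by (simp add: w)
qed simp

lemma dyadic_coord_bounds:
  "real (word_value j (map x [0..<n])) / 2 ^ n \<le> dyadic_coord j x"
  "dyadic_coord j x \<le> (real (word_value j (map x [0..<n])) + 1) / 2 ^ n"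
proof -
  define h where "h k = real (letter_digit j (x k)) * (1 / 2) ^ Suc k" for k
  have h: "0 \<le> h k" "h k \<le> (1 / 2) ^ Suc k" for k
    using letter_digit_le_1[of j "x k"] by (simp_all add: h_def mult_left_le_one_le)
  have summ: "summable h"
    by (rule summable_comparison_test'[of "\<lambda>k. (1 / 2) ^ Suc k" 0]) (use h in auto)
  have part: "(\<Sum>k<n. h k) = real (word_value j (map x [0..<n])) / 2 ^ n"
    by (induction n) (auto simp: h_def field_simps)
  have "dyadic_coord j x = suminf h" by (simp only: dyadic_coord_def h_def[abs_def])
  then have eq: "dyadic_coord j x = (\<Sum>k. h (k + n)) + (\<Sum>k<n. h k)"
    using suminf_split_initial_segment[OF summ, of n] by simp
  have summ': "summable (\<lambda>k. h (k + n))" using summ by (rule summable_ignore_initial_segment)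
  have "0 \<le> (\<Sum>k. h (k + n))" using summ' h by (intro suminf_nonneg) auto
  then show "real (word_value j (map x [0..<n])) / 2 ^ n \<le> dyadic_coord j x"
    using eq part by simp
  have geo: "(\<lambda>k. (1 / 2 :: real) ^ Suc (k + n)) sums (1 / 2) ^ n"
    using sums_mult[OF power_half_series, of "(1 / 2) ^ n"] by (simp add: power_add mult_ac)
  have "(\<Sum>k. h (k + n)) \<le> (\<Sum>k. (1 / 2) ^ Suc (k + n))"
    using summ' h geo by (intro suminf_le) (auto simp: sums_iff)
  also have "\<dots> = (1 / 2) ^ n" using geo by (simp add: sums_iff)
  finally show "dyadic_coord j x \<le> (real (word_value j (map x [0..<n])) + 1) / 2 ^ n"
    using eq part by (simp add: field_simps power_divide)
qed

lemma norm_le_2: "norm v \<le> \<bar>v $ 1\<bar> + \<bar>v $ 2\<bar>" for v :: "real ^ 2"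
  using norm_le_l1_cart[of v] by (simp add: sum_2)

lemma dyadic_point_dist:
  assumes "x \<in> cyl w" "y \<in> cyl w"
  shows "dist (dyadic_point x) (dyadic_point y) \<le> 2 * (1 / 2) ^ length w"
proof -
  let ?n = "length w"
  have "map x [0..<?n] = w" "map y [0..<?n] = w"
    using assms by (auto simp: cyl_def intro!: nth_equalityI)
  then have "\<bar>dyadic_coord j x - dyadic_coord j y\<bar> \<le> (1 / 2) ^ ?n" for j
    using dyadic_coord_bounds[of j x ?n] dyadic_coord_bounds[of j y ?n]
    by (simp add: power_divide add_divide_distrib abs_le_iff)
  from this[of 1] this[of 2] show ?thesis
    using norm_le_2[of "dyadic_point x - dyadic_point y"] by (simp add: dist_norm)
qed

lemma continuous_on_dyadic_point: "continuous_on UNIV dyadic_point"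
  unfolding continuous_on_def
proof
  fix x
  show "(dyadic_point \<longlongrightarrow> dyadic_point x) (at x)"
  proof (rule tendstoI)
    fix e :: real assume "0 < e"
    then obtain n where n: "(1 / 2) ^ n < e / 2" using real_arch_pow_inv[of "e / 2" "1 / 2"] by auto
    have "\<forall>\<^sub>F y in at x. y \<in> cyl (map x [0..<n])"
      using open_cyl map_in_cyl by (intro eventually_at_in_open') auto
    then show "\<forall>\<^sub>F y in at x. dist (dyadic_point y) (dyadic_point x) < e"
    proof eventually_elim
      case (elim y)
      then show ?case
        using dyadic_point_dist[OF elim map_in_cyl] n by simp
    qed
  qed
qed

lemma measurable_dyadic_point: "dyadic_point \<in> seq_algebra \<rightarrow>\<^sub>M borel"
  unfolding dyadic_point_def dyadic_coord_def by measurable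

lemma dyadic_point_surj:
  assumes "\<And>j. 0 \<le> y $ j" "\<And>j. y $ j < 1"
  obtains x where "\<And>i. x i < 4" "dyadic_point x = y"
proof -
  define d where "d j k = nat (\<lfloor>2 ^ Suc k * y $ j\<rfloor> mod 2)" for j k
  have d: "d j k < 2" for j k by (simp add: d_def nat_less_iff)
  define x where "x k = d 1 k + 2 * d 2 k" for k
  have x: "x k < 4" for k using d[of 1 k] d[of 2 k] by (simp add: x_def)
  have digit: "letter_digit j (x k) = d j k" for j k
    using exhaust_2[of j] d[of 1 k] d[of 2 k] by (auto simp: letter_digit_def x_def)
  have val: "int (word_value j (map x [0..<n])) = \<lfloor>2 ^ n * y $ j\<rfloor>" for j n
  proof (induction n)
    case 0
    then show ?case using assms by (simp add: floor_eq_iff)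
  next
    case (Suc n)
    have "\<lfloor>2 ^ Suc n * y $ j\<rfloor> div 2 = \<lfloor>2 ^ n * y $ j\<rfloor>"
      using floor_divide_real_eq_div[of 2 "2 ^ Suc n * y $ j"] by simp
    then show ?case
      using Suc by (simp add: digit d_def) (metis mult_div_mod_eq)
  qed
  have "dyadic_coord j x = y $ j" for j
  proof -
    have "\<bar>dyadic_coord j x - y $ j\<bar> \<le> (1 / 2) ^ n" for n
    proof -
      let ?v = "real (word_value j (map x [0..<n]))"
      have "?v = of_int \<lfloor>2 ^ n * y $ j\<rfloor>" using val[where j=j and n=n] by (metis of_int_of_nat_eq)
      then have "?v \<le> 2 ^ n * y $ j" "2 ^ n * y $ j \<le> ?v + 1"
        by (auto simp: real_of_int_floor_add_one_ge)
      then have "?v / 2 ^ n \<le> y $ j" "y $ j \<le> (?v + 1) / 2 ^ n"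
        by (auto simp: field_simps)
      then show ?thesis
        using dyadic_coord_bounds[where j=j and x=x and n=n]
        by (simp add: power_divide add_divide_distrib abs_le_iff)
    qed
    then have "\<bar>dyadic_coord j x - y $ j\<bar> \<le> 0"
      by (intro LIMSEQ_le_const[OF LIMSEQ_power_zero[of "1 / 2"]]) auto
    then show ?thesis by simp
  qed
  then have "dyadic_point x = y" by (simp add: vec_eq_iff)
  with x show ?thesis by (rule that)
qed

text \<open>A dyadic square of side 2^(-n) within distance 2^(-n) of \<open>y\<close> has, in each
  coordinate, one of four consecutive integers as its scaled corner; two coordinates give
  16.\<close>

lemma card_cyl_near_point:
  fixes y :: "real ^ 2" and n :: nat
  defines "S \<equiv> {w. length w = n \<and> (\<forall>a\<in>set w. a < 4) \<and> (\<exists>x\<in>cyl w. dist y (dyadic_point x) \<le> (1 / 2) ^ n)}"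
  shows "finite S" "card S \<le> 16"
proof -
  define I where "I j = {\<lfloor>2 ^ n * y $ j\<rfloor> - 2..\<lfloor>2 ^ n * y $ j\<rfloor> + 1}" for j
  define p where "p w = (int (word_value 1 w), int (word_value 2 w))" for w
  have inj: "inj_on p S"
  proof (rule inj_onI)
    fix v w assume vw: "v \<in> S" "w \<in> S" "p v = p w"
    have "word_value j v = word_value j w" for j
      using vw(3) exhaust_2[of j] by (auto simp: p_def)
    then show "v = w"
      using vw(1,2) by (intro word_value_inject) (simp_all add: S_def)
  qed
  have I: "int (word_value j w) \<in> I j" if "w \<in> S" for j w
  proof -
    obtain x where x: "x \<in> cyl w" "dist y (dyadic_point x) \<le> (1 / 2) ^ n" and n: "length w = n"
      using \<open>w \<in> S\<close> by (auto simp: S_def)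
    then have w: "map x [0..<n] = w" by (auto simp: cyl_def intro!: nth_equalityI)
    have "\<bar>y $ j - dyadic_coord j x\<bar> \<le> (1 / 2) ^ n"
      using x(2) component_le_norm_cart[of "y - dyadic_point x" j] by (simp add: dist_norm)
    then have "\<bar>y $ j - dyadic_coord j x\<bar> * 2 ^ n \<le> 1"
      by (simp add: field_simps power_divide)
    then have "\<bar>2 ^ n * y $ j - 2 ^ n * dyadic_coord j x\<bar> \<le> 1"
      using abs_mult[of "2 ^ n" "y $ j - dyadic_coord j x"] by (simp add: right_diff_distrib mult.commute)
    moreover have "real (word_value j w) \<le> 2 ^ n * dyadic_coord j x"
      "2 ^ n * dyadic_coord j x \<le> real (word_value j w) + 1"
      using dyadic_coord_bounds[of j x n] by (auto simp: w field_simps)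
    ultimately have "real (word_value j w) - 1 \<le> 2 ^ n * y $ j"
      "2 ^ n * y $ j \<le> real (word_value j w) + 2"
      by linarith+
    then show ?thesis unfolding I_def by (auto simp: le_floor_iff floor_le_iff) linarith+
  qed
  then have sub: "p ` S \<subseteq> I 1 \<times> I 2"
    by (auto simp: p_def)
  have "finite (I 1 \<times> I 2)" by (auto simp: I_def)
  with sub have fin: "finite (p ` S)" by (rule finite_subset)
  then show "finite S" using inj by (simp add: finite_image_iff)
  have "card S = card (p ` S)" using inj by (simp add: card_image)
  also have "\<dots> \<le> card (I 1 \<times> I 2)" using sub \<open>finite (I 1 \<times> I 2)\<close> by (rule card_mono[rotated])
  also have "\<dots> = 16" by (simp add: I_def card_cartesian_product)
  finally show "card S \<le> 16" .
qed

section \<open>Frostman measures\<close>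

lemma compact_imp_closed_seq:
  fixes K :: "(nat \<Rightarrow> nat) set"
  assumes "compact K"
  shows "closed K"
proof -
  have "Hausdorff_space (euclidean :: nat topology)"
    unfolding Hausdorff_space_def disjnt_def by (auto dest!: hausdorff)
  then have "Hausdorff_space (euclidean :: (nat \<Rightarrow> nat) topology)"
    unfolding euclidean_product_topology[symmetric] Hausdorff_space_product_topology by simp
  then show ?thesis using assms compactin_imp_closedin by (metis closed_closedin compactin_euclidean_iff)
qed

definition square_code :: "real ^ 2 \<Rightarrow> (real ^ 2) set \<Rightarrow> (nat \<Rightarrow> nat) set" where
  "square_code z E = {x. (\<forall>i. x i < 4) \<and> z + dyadic_point x \<in> E}"

lemma ediameter_le:
  assumes "\<And>x y. x \<in> U \<Longrightarrow> y \<in> U \<Longrightarrow> mdist m x y \<le> d"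
  shows "ediameter m U \<le> ennreal d"
  unfolding ediameter_def by (intro SUP_least ennreal_leI assms)

text \<open>The image of a cylinder of length \<open>k\<close> has diameter at most twice 2^(-k), so
  a cylinder cover becomes a cover of \<open>E\<close> at the cost of a factor
  \<open>2 powr s\<close>. On the half-open square the floor digits provide a code for every
  point.\<close>

lemma net_content_0_imp_hausdorff_measure_0:
  fixes E :: "(real ^ 2) set"
  assumes s: "0 < s" and E: "\<And>y j. y \<in> E \<Longrightarrow> z $ j \<le> y $ j \<and> y $ j < z $ j + 1"
    and 0: "net_content ((1 / 2) powr s) (square_code z E) = 0"
  shows "hausdorff_measure euclidean_metric s E = 0"
proof (rule hausdorff_measure_eq_0I[OF s])
  fix \<epsilon> :: ennreal assume "0 < \<epsilon>"
  define q where "q = (1 / 2 :: real) powr s"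
  have "0 < \<epsilon> / ennreal (2 powr s)" using \<open>0 < \<epsilon>\<close> by (simp add: ennreal_zero_less_divide)
  then obtain S where S: "square_code z E \<subseteq> (\<Union>w\<in>S. cyl w)"
    "emeasure (node_weight q) S < \<epsilon> / ennreal (2 powr s)"
    using net_content_cover[of "\<epsilon> / ennreal (2 powr s)" "square_code z E" q] 0 by (auto simp: q_def)
  define V where "V w = (if w \<in> S then (\<lambda>x. z + dyadic_point x) ` cyl w else {})" for w
  have V_diam: "ediameter euclidean_metric (V w) \<le> ennreal (2 * (1 / 2) ^ length w)" for w
    using dyadic_point_dist[of _ w] by (intro ediameter_le) (auto simp: V_def split: if_splits)
  have V_powr: "diam_powr euclidean_metric s (V w)
      \<le> ennreal (2 powr s) * (ennreal (q ^ length w) * indicator S w)" for w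
  proof (cases "w \<in> S")
    case True
    have "enn2real (ediameter euclidean_metric (V w)) \<le> 2 * (1 / 2) ^ length w"
      using enn2real_mono[OF V_diam[of w]] by simp
    then have "enn2real (ediameter euclidean_metric (V w)) powr s \<le> (2 * (1 / 2) ^ length w) powr s"
      using s by (intro powr_mono2) auto
    also have "\<dots> = 2 powr s * q ^ length w"
      by (simp add: powr_mult q_def powr_powr mult.commute flip: powr_realpow)
    finally show ?thesis
      using s True ennreal_leI by (auto simp: diam_powr_def q_def simp flip: ennreal_mult)
  qed (simp add: V_def diam_powr_def)
  have "E \<subseteq> (\<Union>i. V (list_decode i))"
  proof
    fix y assume "y \<in> E"
    then have "0 \<le> (y - z) $ j \<and> (y - z) $ j < 1" for j using E[of y j] by simp
    then obtain x where x: "\<And>i. x i < 4" "dyadic_point x = y - z"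
      using dyadic_point_surj[of "y - z"] by blast
    then have "x \<in> square_code z E" using \<open>y \<in> E\<close> by (simp add: square_code_def)
    then obtain w where w: "w \<in> S" "x \<in> cyl w" using S(1) by blast
    then have "y \<in> V w" using x by (auto simp: V_def intro!: image_eqI[of _ _ x])
    then have "y \<in> V (list_decode (list_encode w))" by simp
    then show "y \<in> (\<Union>i. V (list_decode i))" by blast
  qed
  moreover have "ediameter euclidean_metric (V w) < top" for w
    using V_diam[of w] ennreal_less_top le_less_trans by blast
  moreover have "(\<Sum>i. diam_powr euclidean_metric s (V (list_decode i))) < \<epsilon>"
  proof -
    have "(\<Sum>i. diam_powr euclidean_metric s (V (list_decode i)))
        = (\<integral>\<^sup>+w. diam_powr euclidean_metric s (V w) \<partial>count_space UNIV)"
      using nn_integral_bij_count_space[OF bij_list_decode] by (simp flip: nn_integral_count_space_nat)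
    also have "\<dots> \<le> (\<integral>\<^sup>+w. ennreal (2 powr s) * (ennreal (q ^ length w) * indicator S w) \<partial>count_space UNIV)"
      by (intro nn_integral_mono V_powr)
    also have "\<dots> = ennreal (2 powr s) * emeasure (node_weight q) S"
      by (simp add: nn_integral_cmult emeasure_node_weight)
    also have "\<dots> < ennreal (2 powr s) * (\<epsilon> / ennreal (2 powr s))"
      by (rule ennreal_mult_strict_left_mono[OF S(2)]) auto
    also have "\<dots> = \<epsilon>"
      by (simp add: ennreal_times_divide ennreal_mult_divide_eq mult.commute)
    finally show ?thesis .
  qed
  ultimately show "\<exists>U :: nat \<Rightarrow> (real ^ 2) set. E \<subseteq> (\<Union>i. U i) \<and>
      (\<forall>i. U i \<subseteq> mspace euclidean_metric \<and> ediameter euclidean_metric (U i) < top) \<and>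
      (\<Sum>i. diam_powr euclidean_metric s (U i)) < \<epsilon>"
    by (intro exI[of _ "\<lambda>i. V (list_decode i)"]) auto
qed

text \<open>A ball of radius \<open>r\<close> with 2^(-n-1) < r and r \<le> 2^(-n) is reached from
  \<open>K\<close> by at most 16 words of length \<open>n\<close>, each of mass at most
  \<open>q ^ n \<le> (2 * r) powr s\<close>; hence the constant \<open>16 * 2 powr s\<close>. For
  \<open>r > 1\<close> the total mass, at most 1, suffices.\<close>

lemma frostman_square:
  fixes E :: "(real ^ 2) set"
  assumes E: "E \<in> sets borel" and s: "0 < s"
    and pos: "0 < net_content ((1 / 2) powr s) (square_code z E)"
  obtains \<mu> :: "(real ^ 2) measure" and c where "sets \<mu> = sets borel" "finite_measure \<mu>"
    "0 < emeasure \<mu> UNIV" "- E \<in> null_sets \<mu>" "0 \<le> c"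
    "\<And>y r. 0 < r \<Longrightarrow> emeasure \<mu> (cball y r) \<le> ennreal (c * r powr s)"
proof -
  define q where "q = (1 / 2 :: real) powr s"
  let ?h = "\<lambda>x. z + dyadic_point x"
  obtain C0 :: "((nat \<Rightarrow> nat) \<times> (real ^ 2)) set" where C0: "closed C0" "E = snd ` C0"
    using borel_imp_analytic[OF E] .
  \<comment> \<open>The code map acts on the second factor only and the witness is kept, so the
    representation of \<open>E\<close> as a projection pulls back to one of its code set.\<close>
  define C where "C = (UNIV \<times> {x. \<forall>i. x i \<le> 3}) \<inter> (\<lambda>(s, x). (s, ?h x)) -` C0"
  have "closed C"
    unfolding C_def case_prod_unfold
  proof (intro closed_Int closed_Times closed_UNIV closed_vimage C0)
    show "closed {x :: nat \<Rightarrow> nat. \<forall>i. x i \<le> 3}"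
      using compact_box[of "\<lambda>_. 3"] by (rule compact_imp_closed_seq)
    show "continuous_on UNIV (\<lambda>p :: (nat \<Rightarrow> nat) \<times> (nat \<Rightarrow> nat). (fst p, ?h (snd p)))"
      by (intro continuous_intros continuous_on_compose2[OF continuous_on_dyadic_point]) auto
  qed
  have snd_C: "snd ` C = square_code z E"
  proof -
    have "(a < 4) = (a \<le> 3)" for a :: nat by linarith
    then show ?thesis unfolding C_def C0 square_code_def by force
  qed
  obtain c where c: "0 < c" "c < net_content q (square_code z E)"
    using pos dense unfolding q_def by blast
  obtain K where K: "compact K" "K \<subseteq> square_code z E" "c \<le> net_content q K"
  proof -
    have "x i < 4" if "(s, x) \<in> C" for s x i
      using that by (auto simp: C_def dest!: spec[of _ i])
    then show ?thesis
      using net_content_capacitable[OF \<open>closed C\<close>, of 4 c q] c(2) snd_C that by metis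
  qed
  have "K \<subseteq> {x. \<forall>i. x i < 4}" using K(2) by (auto simp: square_code_def)
  then obtain M where M: "sets M = sets seq_algebra" "emeasure M UNIV = net_content q K"
    "\<And>w. emeasure M (cyl w) \<le> ennreal (q ^ length w)" "- K \<in> null_sets M"
    using net_content_measure[of K 4 q] compact_imp_closed_seq[OF K(1)] by (auto simp: q_def)
  have space_M: "space M = UNIV" using sets_eq_imp_space_eq[OF M(1)] by (simp add: space_PiM)
  have h: "?h \<in> M \<rightarrow>\<^sub>M borel"
    using measurable_dyadic_point by (simp add: measurable_cong_sets[OF M(1) refl])
  define \<mu> where "\<mu> = distr M borel ?h"
  have em: "emeasure \<mu> A = emeasure M (?h -` A)" if "A \<in> sets borel" for A
    using that h by (simp add: \<mu>_def emeasure_distr space_M)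
  have \<mu>_1: "emeasure \<mu> A \<le> 1" for A
  proof -
    have "emeasure \<mu> A \<le> emeasure \<mu> (space \<mu>)" by (rule emeasure_space)
    also have "\<dots> \<le> 1" using M(2) net_content_le_1 by (simp add: \<mu>_def em[unfolded \<mu>_def])
    finally show ?thesis .
  qed
  show ?thesis
  proof
    show "sets \<mu> = sets borel" by (simp add: \<mu>_def)
    show "finite_measure \<mu>"
      by (rule finite_measureI) (metis \<mu>_1 ennreal_one_less_top le_less_trans infinity_ennreal_def less_irrefl)
    show "0 < emeasure \<mu> UNIV" using c K(3) M(2) by (simp add: em)
    have "?h -` (- E) \<subseteq> - K" using K(2) by (auto simp: square_code_def)
    then have "emeasure M (?h -` (- E)) \<le> emeasure M (- K)"
      using M(4) by (intro emeasure_mono) auto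
    then show "- E \<in> null_sets \<mu>"
      using M(4) E by (auto simp: null_sets_def em) (simp add: \<mu>_def)
  next
    fix y :: "real ^ 2" and r :: real assume r: "0 < r"
    show "emeasure \<mu> (cball y r) \<le> ennreal (16 * 2 powr s * r powr s)"
    proof (cases "r \<le> 1")
      case False
      have "1 \<le> 16 * 2 powr s * r powr s"
        using False s by (intro mult_ge1_I ge_one_powr_ge_zero) auto
      then show ?thesis using \<mu>_1[of "cball y r"] by (metis ennreal_1 ennreal_leI order_trans)
    next
      case True
      define n where "n = (LEAST n. (1 / 2) ^ Suc n < r)"
      have "\<exists>n. (1 / 2) ^ Suc n < r"
      proof -
        obtain n where "(1 / 2) ^ n < r" using real_arch_pow_inv[OF r, of "1 / 2"] by auto
        then have "(1 / 2) ^ Suc n < r" using r by (simp add: field_simps)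
        then show ?thesis ..
      qed
      then have n1: "(1 / 2) ^ Suc n < r" unfolding n_def by (rule LeastI_ex)
      have n2: "r \<le> (1 / 2) ^ n"
      proof (cases n)
        case 0
        then show ?thesis using True by simp
      next
        case (Suc k)
        then have "\<not> (1 / 2) ^ Suc k < r" unfolding n_def by (intro not_less_Least) simp
        then show ?thesis using Suc by simp
      qed
      define S where "S = {w. length w = n \<and> (\<forall>a\<in>set w. a < 4) \<and>
        (\<exists>x\<in>cyl w. dist (y - z) (dyadic_point x) \<le> (1 / 2) ^ n)}"
      have S: "finite S" "card S \<le> 16"
        unfolding S_def using card_cyl_near_point[of n "y - z"] by auto
      have "?h -` cball y r \<subseteq> - K \<union> (\<Union>w\<in>S. cyl w)"
      proof
        fix x assume x: "x \<in> ?h -` cball y r"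
        show "x \<in> - K \<union> (\<Union>w\<in>S. cyl w)"
        proof (cases "x \<in> K")
          case True
          then have "\<forall>i. x i < 4" using K(2) by (auto simp: square_code_def)
          moreover have "dist (y - z) (dyadic_point x) \<le> (1 / 2) ^ n"
            using x n2 by (auto simp: dist_norm algebra_simps)
          ultimately have "map x [0..<n] \<in> S"
            using map_in_cyl[of x n] by (auto simp: S_def)
          then show ?thesis using map_in_cyl by blast
        qed auto
      qed
      then have "emeasure M (?h -` cball y r) \<le> emeasure M (- K \<union> (\<Union>w\<in>S. cyl w))"
        using M(1,4) cyl_in_sets S(1) by (intro emeasure_mono) auto
      also have "\<dots> \<le> emeasure M (- K) + emeasure M (\<Union>w\<in>S. cyl w)"
        using M(1,4) cyl_in_sets S(1) by (intro emeasure_subadditive) auto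
      also have "\<dots> \<le> 0 + (\<Sum>w\<in>S. emeasure M (cyl w))"
        using M(1,4) cyl_in_sets S(1) by (intro add_mono emeasure_subadditive_finite) auto
      also have "\<dots> \<le> (\<Sum>w\<in>S. ennreal (q ^ n))"
      proof -
        have "emeasure M (cyl w) \<le> ennreal (q ^ n)" if "w \<in> S" for w
          using M(3)[of w] that by (simp add: S_def)
        then show ?thesis by (simp only: add_0 sum_mono)
      qed
      also have "\<dots> = ennreal (card S * q ^ n)"
        by (simp add: ennreal_mult ennreal_of_nat_eq_real_of_nat q_def)
      also have "\<dots> \<le> ennreal (16 * 2 powr s * r powr s)"
      proof (intro ennreal_leI)
        have "q ^ n = ((1 / 2) ^ n) powr s"
          by (simp add: q_def powr_powr mult.commute flip: powr_realpow)
        also have "\<dots> \<le> (2 * r) powr s" using n1 s by (intro powr_mono2) auto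
        also have "\<dots> = 2 powr s * r powr s" using r by (simp add: powr_mult)
        finally have "q ^ n \<le> 2 powr s * r powr s" .
        then show "card S * q ^ n \<le> 16 * 2 powr s * r powr s"
          using S(2) mult_mono[of "real (card S)" 16 "q ^ n" "2 powr s * r powr s"]
          by (simp add: q_def)
      qed
      finally show ?thesis by (simp add: em)
    qed
  qed simp
qed

text \<open>Countably many half-open unit squares with integer corners cover the plane; if the codes
  of \<open>E\<close> in every one of them had zero content, \<open>E\<close> would be a countable
  union of null sets.\<close>

lemma frostman:
  fixes E :: "(real ^ 2) set"
  assumes E: "E \<in> sets borel" and s: "0 < s" and pos: "hausdorff_measure euclidean_metric s E \<noteq> 0"
  obtains \<mu> :: "(real ^ 2) measure" and c where "sets \<mu> = sets borel" "finite_measure \<mu>"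
    "0 < emeasure \<mu> UNIV" "- E \<in> null_sets \<mu>" "0 \<le> c"
    "\<And>y r. 0 < r \<Longrightarrow> emeasure \<mu> (cball y r) \<le> ennreal (c * r powr s)"
proof -
  define z :: "nat \<Rightarrow> real ^ 2" where
    "z n = (\<chi> j. of_int (if j = 1 then fst (from_nat n :: int \<times> int) else snd (from_nat n :: int \<times> int)))" for n
  have "\<exists>n. 0 < net_content ((1 / 2) powr s) (square_code (z n) E)"
  proof (rule ccontr)
    assume "\<nexists>n. 0 < net_content ((1 / 2) powr s) (square_code (z n) E)"
    then have 0: "net_content ((1 / 2) powr s) (square_code (z n) E) = 0" for n
      by (simp add: zero_less_iff_neq_zero)
    define F where "F n = {y \<in> E. \<forall>j. z n $ j \<le> y $ j \<and> y $ j < z n $ j + 1}" for n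
    have "hausdorff_measure euclidean_metric s (F n) = 0" for n
    proof (rule net_content_0_imp_hausdorff_measure_0[OF s, of "F n" "z n"])
      have "net_content ((1 / 2) powr s) (square_code (z n) (F n))
          \<le> net_content ((1 / 2) powr s) (square_code (z n) E)"
        by (intro net_content_mono) (auto simp: square_code_def F_def)
      then show "net_content ((1 / 2) powr s) (square_code (z n) (F n)) = 0" using 0 by simp
    qed (simp add: F_def)
    then have "hausdorff_measure euclidean_metric s (\<Union>n. F n) = 0"
      by (rule hausdorff_measure_eq_0_UN[OF s])
    moreover have "E \<subseteq> (\<Union>n. F n)"
    proof
      fix y assume "y \<in> E"
      moreover have "z (to_nat (\<lfloor>y $ 1\<rfloor>, \<lfloor>y $ 2\<rfloor>)) $ j = of_int \<lfloor>y $ j\<rfloor>" for j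
        using exhaust_2[of j] by (auto simp: z_def)
      ultimately have "y \<in> F (to_nat (\<lfloor>y $ 1\<rfloor>, \<lfloor>y $ 2\<rfloor>))"
        by (simp add: F_def)
      then show "y \<in> (\<Union>n. F n)" by blast
    qed
    ultimately show False using pos hausdorff_measure_mono by (metis le_zero_eq)
  qed
  then show ?thesis using frostman_square[OF E s] that by metis
qed

section \<open>Radial projections from the points of a line\<close>

text \<open>An orthonormal frame with origin \<open>p\<close>. No assumption involves
  \<open>p\<close>, so the locale predicate takes only \<open>e\<close> and \<open>n\<close>, while
  outside the locale the coordinates take \<open>p\<close> as an argument as well.\<close>

locale line_frame =
  fixes p e n :: "real ^ 2"
  assumes norm_e: "norm e = 1" and norm_n: "norm n = 1" and orth: "e \<bullet> n = 0"
    and decomp: "v = (v \<bullet> e) *\<^sub>R e + (v \<bullet> n) *\<^sub>R n"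
begin

definition xi :: "real ^ 2 \<Rightarrow> real" where "xi b = (b - p) \<bullet> e"
definition eta :: "real ^ 2 \<Rightarrow> real" where "eta b = (b - p) \<bullet> n"

text \<open>For \<open>a\<close> on the line \<open>eta = 0\<close>, the line through \<open>a\<close> and \<open>b\<close> has direction
  \<open>slope a b *\<^sub>R e + n\<close>.\<close>

definition slope :: "real ^ 2 \<Rightarrow> real ^ 2 \<Rightarrow> real" where
  "slope a b = (xi b - xi a) / eta b"

definition base_points :: "real \<Rightarrow> (real ^ 2) set" where
  "base_points R = {a. eta a = 0 \<and> \<bar>xi a\<bar> \<le> R}"

text \<open>Staying away from the line \<open>eta = 0\<close> bounds the slopes and makes the
  constants below uniform in the points.\<close>

definition off_points :: "real \<Rightarrow> (real ^ 2) set" where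
  "off_points R = {b. 1 / R \<le> \<bar>eta b\<bar> \<and> \<bar>eta b\<bar> \<le> R \<and> \<bar>xi b\<bar> \<le> R}"

lemma measurable_frame [measurable]:
  "xi \<in> borel_measurable borel" "eta \<in> borel_measurable borel"
  unfolding xi_def eta_def by measurable

lemma e_e: "e \<bullet> e = 1" and n_n: "n \<bullet> n = 1" and n_e: "n \<bullet> e = 0"
  using norm_e norm_n orth by (simp_all add: dot_square_norm inner_commute)

lemma inner_le_norm: "\<bar>v \<bullet> e\<bar> \<le> norm v" "\<bar>v \<bullet> n\<bar> \<le> norm v"
  using Cauchy_Schwarz_ineq2[of v e] Cauchy_Schwarz_ineq2[of v n] norm_e norm_n by auto

lemma dist_le_frame: "dist b b' \<le> \<bar>xi b - xi b'\<bar> + \<bar>eta b - eta b'\<bar>"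
proof -
  have "norm (b - b') \<le> norm (((b - b') \<bullet> e) *\<^sub>R e) + norm (((b - b') \<bullet> n) *\<^sub>R n)"
    by (metis decomp norm_triangle_ineq)
  then show ?thesis
    by (simp add: norm_e norm_n dist_norm xi_def eta_def flip: inner_diff_left)
qed

lemma xi_dist: "eta a = 0 \<Longrightarrow> eta a' = 0 \<Longrightarrow> dist a a' \<le> \<bar>xi a - xi a'\<bar>"
  using dist_le_frame[of a a'] by simp

text \<open>A Lipschitz constant for the inverse of the projective map on
  \<open>off_points R\<close>: \<open>R\<close> and \<open>R ^ 4\<close> come from the two terms in
  the increment of \<open>xi\<close>, \<open>R\<^sup>2\<close> from the increment of
  \<open>eta\<close>.\<close>

definition tube_const :: "real \<Rightarrow> real" where
  "tube_const R = R + R\<^sup>2 + R ^ 4"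

text \<open>The projective map \<open>b \<mapsto> (xi b / eta b, 1 / eta b)\<close> turns the radial projections
  \<open>slope a\<close> into linear functionals \<open>(x, y) \<mapsto> x - xi a * y\<close>, which depend transversally on \<open>a\<close>.\<close>

lemma slope_transversal:
  assumes R: "0 < R" and a: "a \<in> base_points R" "a0 \<in> base_points R"
    and b: "b \<in> off_points R" "b' \<in> off_points R"
    and r: "\<bar>slope a b - slope a b'\<bar> \<le> r" "\<bar>slope a0 b - slope a0 b'\<bar> \<le> r"
    and far: "2 * tube_const R * r \<le> dist b b'"
  shows "\<bar>xi a - xi a0\<bar> * dist b b' \<le> 4 * tube_const R * (R + 1) * r"
proof -
  define K where "K = tube_const R"
  define x x' y y' where "x = xi b / eta b" and "x' = xi b' / eta b'" and "y = 1 / eta b" and "y' = 1 / eta b'"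
  have "0 < 1 / R" using R by simp
  then have nz: "eta b \<noteq> 0" "eta b' \<noteq> 0" using b by (auto simp: off_points_def)
  have sl: "slope c b - slope c b' = (x - x') - xi c * (y - y')" for c
    by (simp add: slope_def x_def x'_def y_def y'_def diff_divide_distrib algebra_simps)
  have bd: "\<bar>eta b\<bar> \<le> R" "\<bar>eta b'\<bar> \<le> R" "\<bar>xi b'\<bar> \<le> R" "1 / R \<le> \<bar>eta b'\<bar>"
    using b by (auto simp: off_points_def)
  have K0: "0 < K" using R by (simp add: K_def tube_const_def add_pos_pos)
  have K: "dist b b' \<le> K * (\<bar>x - x'\<bar> + \<bar>y - y'\<bar>)"
  proof -
    have "eta b - eta b' = eta b * eta b' * (y' - y)"
      using nz by (simp add: y_def y'_def field_simps)
    then have 1: "\<bar>eta b - eta b'\<bar> \<le> R\<^sup>2 * \<bar>y - y'\<bar>"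
      using bd mult_mono[of "\<bar>eta b\<bar>" R "\<bar>eta b'\<bar>" R] R
      by (simp add: abs_mult power2_eq_square abs_minus_commute[of y] mult_right_mono)
    have "\<bar>x'\<bar> \<le> R * R"
    proof -
      have "\<bar>y'\<bar> \<le> R"
        using bd(4) R nz by (simp add: y'_def field_simps abs_divide)
      then have "\<bar>xi b'\<bar> * \<bar>y'\<bar> \<le> R * R"
        using bd R by (intro mult_mono) auto
      then show ?thesis by (simp add: x'_def y'_def abs_divide)
    qed
    then have 2: "\<bar>x'\<bar> * \<bar>eta b - eta b'\<bar> \<le> (R * R) * (R\<^sup>2 * \<bar>y - y'\<bar>)"
      using 1 by (intro mult_mono) auto
    have "xi b - xi b' = (x - x') * eta b + x' * (eta b - eta b')"
      using nz by (simp add: x_def x'_def field_simps)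
    then have "\<bar>xi b - xi b'\<bar> \<le> \<bar>x - x'\<bar> * \<bar>eta b\<bar> + \<bar>x'\<bar> * \<bar>eta b - eta b'\<bar>"
      by (metis abs_mult abs_triangle_ineq)
    also have "\<dots> \<le> \<bar>x - x'\<bar> * R + (R * R) * (R\<^sup>2 * \<bar>y - y'\<bar>)"
      using bd 2 by (intro add_mono mult_left_mono) auto
    finally have "dist b b' \<le> R * \<bar>x - x'\<bar> + (R\<^sup>2 + R ^ 4) * \<bar>y - y'\<bar>"
      using dist_le_frame[of b b'] 1
      by (simp add: algebra_simps power2_eq_square power4_eq_xxxx)
    also have "\<dots> \<le> K * \<bar>x - x'\<bar> + K * \<bar>y - y'\<bar>"
      using R by (intro add_mono mult_right_mono) (auto simp: K_def tube_const_def)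
    finally show ?thesis by (simp add: algebra_simps)
  qed
  have "\<bar>x - x'\<bar> \<le> r + R * \<bar>y - y'\<bar>"
  proof -
    have "\<bar>xi a * (y - y')\<bar> \<le> R * \<bar>y - y'\<bar>"
      using a by (simp add: abs_mult base_points_def mult_right_mono)
    then show ?thesis using r(1) sl[of a] by linarith
  qed
  then have "dist b b' \<le> K * (r + (R + 1) * \<bar>y - y'\<bar>)"
    using K0 by (intro order_trans[OF K] mult_left_mono) (auto simp: algebra_simps)
  \<comment> \<open>Since \<open>K * r\<close> is at most half of \<open>dist b b'\<close>, it is
    absorbed on the left; what remains bounds \<open>\<bar>y - y'\<bar>\<close> from below.\<close>
  then have "dist b b' \<le> 2 * K * (R + 1) * \<bar>y - y'\<bar>"
    using far unfolding K_def[symmetric] by (simp add: algebra_simps)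
  then have "\<bar>xi a - xi a0\<bar> * dist b b' \<le> \<bar>xi a - xi a0\<bar> * (2 * K * (R + 1) * \<bar>y - y'\<bar>)"
    by (intro mult_left_mono) auto
  also have "\<dots> = 2 * K * (R + 1) * \<bar>(xi a - xi a0) * (y - y')\<bar>"
    by (simp add: abs_mult)
  \<comment> \<open>Subtracting the slope identities for \<open>a\<close> and \<open>a0\<close>
    cancels \<open>x - x'\<close>.\<close>
  also have "\<dots> \<le> 2 * K * (R + 1) * (2 * r)"
  proof (intro mult_left_mono)
    show "\<bar>(xi a - xi a0) * (y - y')\<bar> \<le> 2 * r"
      using r sl[of a] sl[of a0] by (simp add: left_diff_distrib)
  qed (use K0 R in auto)
  finally show ?thesis by (simp add: K_def)
qed

section \<open>Kaufman's argument for slopes\<close>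

text \<open>The radial projection from \<open>a\<close> of the restriction of \<open>\<nu>\<close>
  to \<open>B\<close>, evaluated on the interval of radius \<open>r\<close> about
  \<open>slope a b\<close>. As a parameter integral it is jointly measurable in \<open>a\<close> and
  \<open>b\<close>.\<close>

definition slope_count :: "(real ^ 2) measure \<Rightarrow> (real ^ 2) set \<Rightarrow> real \<Rightarrow> real ^ 2 \<Rightarrow> real ^ 2 \<Rightarrow> ennreal" where
  "slope_count \<nu> B r a b = (\<integral>\<^sup>+b'. (if b' \<in> B \<and> \<bar>slope a b - slope a b'\<bar> \<le> r then 1 else 0) \<partial>\<nu>)"

lemma sum_ennreal_geometric:
  assumes "0 \<le> c" "0 \<le> q" "q < 1"
  shows "(\<Sum>k. ennreal (c * q ^ k)) = ennreal (c / (1 - q))"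
proof (rule suminf_ennreal_eq)
  show "(\<lambda>k. c * q ^ k) sums (c / (1 - q))"
    using sums_mult[OF geometric_sums[of q], of c] assms by simp
qed (use assms in auto)

text \<open>Kaufman's estimate: exchanging the order of integration, the measure of the \<open>a\<close> for which
  \<open>slope a\<close> nearly identifies \<open>b\<close> and \<open>b'\<close> is bounded by transversality, on each dyadic annulus
  of \<open>b'\<close> around \<open>b\<close>.\<close>

lemma slope_count_integral:
  assumes sets: "sets \<mu> = sets borel" "sets \<nu> = sets borel"
    and fin: "finite_measure \<mu>" "finite_measure \<nu>"
    and AB: "A \<in> sets borel" "B \<in> sets borel" "A \<subseteq> base_points R" "B \<subseteq> off_points R"
    and R: "0 < R" and st: "0 < t" "t < s" and c: "0 \<le> c" "0 \<le> d"
    and \<mu>: "\<And>y r. 0 < r \<Longrightarrow> emeasure \<mu> (cball y r) \<le> ennreal (c * r powr s)"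
    and \<nu>: "\<And>y r. 0 < r \<Longrightarrow> emeasure \<nu> (cball y r) \<le> ennreal (d * r powr t)"
  obtains C where "0 \<le> C"
    "\<And>r b. 0 < r \<Longrightarrow> b \<in> B \<Longrightarrow> (\<integral>\<^sup>+a. indicator A a * slope_count \<nu> B r a b \<partial>\<mu>) \<le> ennreal (C * r powr t)"
proof -
  note [measurable_cong] = sets
  note [measurable] = AB(1,2)
  interpret M: finite_measure \<mu> by (rule fin)
  interpret N: finite_measure \<nu> by (rule fin)
  interpret P: pair_sigma_finite \<mu> \<nu> ..
  define K where "K = tube_const R"
  have K: "0 < K" using R by (simp add: K_def tube_const_def add_pos_pos)
  define q where "q = (1 / 2 :: real) powr s"
  \<comment> \<open>The first entry serves \<open>j = 0\<close>, where \<open>b'\<close> is too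
    close to \<open>b\<close> for transversality and only the total mass is available. The second
    serves \<open>j = Suc i\<close>, where the set of \<open>a\<close> lies in a ball of radius
    \<open>2 * (R + 1) / 2 ^ i = 4 * (R + 1) / 2 ^ j\<close>.\<close>
  define \<kappa> where "\<kappa> = max (measure \<mu> UNIV) (c * (4 * (R + 1)) powr s)"
  have \<kappa>: "0 \<le> \<kappa>" by (simp add: \<kappa>_def max.coboundedI1)
  have near: "emeasure \<mu> {a \<in> A. \<bar>slope a b - slope a b'\<bar> \<le> r} \<le>
      (\<Sum>j. ennreal (\<kappa> * q ^ j) * indicator (cball b (2 ^ j * (2 * K * r))) b')"
    if r: "0 < r" and b: "b \<in> B" "b' \<in> B" for r b b'
  proof -
    let ?S = "{a \<in> A. \<bar>slope a b - slope a b'\<bar> \<le> r}"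
    define P where "P j \<longleftrightarrow> dist b b' \<le> 2 ^ j * (2 * K * r)" for j :: nat
    have "0 < 2 * K * r" using K r by simp
    have "\<exists>j. P j"
    proof -
      obtain j :: nat where "dist b b' / (2 * K * r) < 2 ^ j"
        using real_arch_pow[of 2] by auto
      then show ?thesis
        using \<open>0 < 2 * K * r\<close> by (intro exI[of _ j]) (simp add: P_def field_simps)
    qed
    define j where "j = (LEAST j. P j)"
    have j: "P j" unfolding j_def using \<open>\<exists>j. P j\<close> by (rule LeastI_ex)
    have "emeasure \<mu> ?S \<le> ennreal (\<kappa> * q ^ j)"
    proof (cases j)
      case 0
      have "emeasure \<mu> ?S \<le> emeasure \<mu> (space \<mu>)" by (rule emeasure_space)
      also have "\<dots> = ennreal (measure \<mu> UNIV)"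
        using sets_eq_imp_space_eq[OF sets(1)] by (simp add: M.emeasure_eq_measure)
      also have "\<dots> \<le> ennreal (\<kappa> * q ^ j)" by (intro ennreal_leI) (simp add: 0 \<kappa>_def)
      finally show ?thesis .
    next
      case (Suc i)
      then have "\<not> P i" unfolding j_def by (intro not_less_Least) simp
      then have far: "2 ^ i * (2 * K * r) < dist b b'" by (simp add: P_def)
      show ?thesis
      proof (cases "?S = {}")
        case False
        then obtain a0 where a0: "a0 \<in> ?S" by blast
        have "?S \<subseteq> cball a0 (2 * (R + 1) / 2 ^ i)"
        proof
          fix a assume a: "a \<in> ?S"
          have "2 * K * r \<le> dist b b'"
          proof -
            have "1 * (2 * K * r) \<le> 2 ^ i * (2 * K * r)"
              using \<open>0 < 2 * K * r\<close> by (intro mult_right_mono) auto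
            then show ?thesis using far by simp
          qed
          then have "\<bar>xi a - xi a0\<bar> * dist b b' \<le> 4 * K * (R + 1) * r"
            unfolding K_def using a a0 b AB R by (intro slope_transversal) auto
          moreover have "\<bar>xi a - xi a0\<bar> * (2 ^ i * (2 * K * r)) \<le> \<bar>xi a - xi a0\<bar> * dist b b'"
            using far by (intro mult_left_mono) auto
          ultimately have "(\<bar>xi a - xi a0\<bar> * 2 ^ i) * (2 * K * r) \<le> (2 * (R + 1)) * (2 * K * r)"
            by (simp add: mult_ac)
          then have "\<bar>xi a - xi a0\<bar> * 2 ^ i \<le> 2 * (R + 1)"
            using \<open>0 < 2 * K * r\<close> by (rule mult_right_le_imp_le)
          then have "\<bar>xi a - xi a0\<bar> \<le> 2 * (R + 1) / 2 ^ i" by (simp add: field_simps)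
          moreover have "dist a0 a \<le> \<bar>xi a - xi a0\<bar>"
            using a a0 AB by (subst dist_commute) (auto intro!: xi_dist simp: base_points_def)
          ultimately show "a \<in> cball a0 (2 * (R + 1) / 2 ^ i)" by simp
        qed
        then have "emeasure \<mu> ?S \<le> emeasure \<mu> (cball a0 (2 * (R + 1) / 2 ^ i))"
          by (intro emeasure_mono) (auto simp: sets)
        also have "\<dots> \<le> ennreal (c * (2 * (R + 1) / 2 ^ i) powr s)"
          using R by (intro \<mu>) simp
        also have "\<dots> \<le> ennreal (\<kappa> * q ^ j)"
        proof (rule ennreal_leI)
          have "2 * (R + 1) / 2 ^ i = (4 * (R + 1)) * (1 / 2) ^ j"
            by (simp add: Suc power_divide field_simps)
          then have "(2 * (R + 1) / 2 ^ i) powr s = (4 * (R + 1)) powr s * ((1 / 2) ^ j) powr s"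
            using R by (simp only: powr_mult)
          also have "((1 / 2 :: real) ^ j) powr s = q ^ j"
            by (simp add: q_def powr_powr mult.commute flip: powr_realpow)
          finally show "c * (2 * (R + 1) / 2 ^ i) powr s \<le> \<kappa> * q ^ j"
            by (simp add: \<kappa>_def q_def flip: mult.assoc)
        qed
        finally show ?thesis .
      qed (simp only: emeasure_empty zero_le)
    qed
    also have "\<dots> = ennreal (\<kappa> * q ^ j) * indicator (cball b (2 ^ j * (2 * K * r))) b'"
      using j by (simp add: P_def)
    also have "\<dots> \<le> (\<Sum>j. ennreal (\<kappa> * q ^ j) * indicator (cball b (2 ^ j * (2 * K * r))) b')"
      using sum_le_suminf[of "\<lambda>j. ennreal (\<kappa> * q ^ j) * indicator (cball b (2 ^ j * (2 * K * r))) b'" "{j}"]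
      by (simp del: sum_mult_indicator mem_cball)
    finally show ?thesis .
  qed
  \<comment> \<open>The term of index \<open>j\<close> has a factor \<open>q ^ j\<close> from
    \<open>\<mu>\<close> and a factor \<open>(2 ^ j) powr t\<close> from \<open>\<nu>\<close>; the
    resulting ratio is below 1 because \<open>t < s\<close>.\<close>
  define q' where "q' = (2 :: real) powr (t - s)"
  have q': "0 < q'" "q' < 1" using st by (auto simp: q'_def powr_less_one)
  define C where "C = \<kappa> * d * (2 * K) powr t / (1 - q')"
  show ?thesis
  proof
    show "0 \<le> C" using \<kappa> c q' by (simp add: C_def)
    fix r b assume r: "(0 :: real) < r" and b: "b \<in> B"
    have [measurable]: "(\<lambda>x. slope (fst x) b) \<in> borel_measurable (\<mu> \<Otimes>\<^sub>M \<nu>)"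
      "(\<lambda>x. slope (fst x) (snd x)) \<in> borel_measurable (\<mu> \<Otimes>\<^sub>M \<nu>)"
      "\<And>b. (\<lambda>a. slope a b) \<in> borel_measurable \<mu>"
      "\<And>a. (\<lambda>b. slope a b) \<in> borel_measurable \<nu>"
      unfolding slope_def by measurable
    let ?f = "\<lambda>a b'. (if a \<in> A \<and> b' \<in> B \<and> \<bar>slope a b - slope a b'\<bar> \<le> r then 1 else 0) :: ennreal"
    have "(\<integral>\<^sup>+a. indicator A a * slope_count \<nu> B r a b \<partial>\<mu>) = (\<integral>\<^sup>+a. \<integral>\<^sup>+b'. ?f a b' \<partial>\<nu> \<partial>\<mu>)"
      unfolding slope_count_def
      by (intro nn_integral_cong) (auto simp: indicator_def intro!: nn_integral_cong)
    also have "\<dots> = (\<integral>\<^sup>+b'. \<integral>\<^sup>+a. ?f a b' \<partial>\<mu> \<partial>\<nu>)"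
      by (rule P.Fubini'[symmetric]) (simp add: case_prod_unfold, measurable)
    also have "\<dots> \<le> (\<integral>\<^sup>+b'. (\<Sum>j. ennreal (\<kappa> * q ^ j) * indicator (cball b (2 ^ j * (2 * K * r))) b') \<partial>\<nu>)"
    proof (intro nn_integral_mono)
      fix b'
      show "(\<integral>\<^sup>+a. ?f a b' \<partial>\<mu>) \<le> (\<Sum>j. ennreal (\<kappa> * q ^ j) * indicator (cball b (2 ^ j * (2 * K * r))) b')"
      proof (cases "b' \<in> B")
        case True
        have "(\<integral>\<^sup>+a. ?f a b' \<partial>\<mu>) = (\<integral>\<^sup>+a. indicator {a \<in> A. \<bar>slope a b - slope a b'\<bar> \<le> r} a \<partial>\<mu>)"
          using True by (intro nn_integral_cong) (auto simp: indicator_def)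
        also have "\<dots> = emeasure \<mu> {a \<in> A. \<bar>slope a b - slope a b'\<bar> \<le> r}"
        proof (rule nn_integral_indicator)
          have "{a \<in> A. \<bar>slope a b - slope a b'\<bar> \<le> r} = {a \<in> space \<mu>. a \<in> A \<and> \<bar>slope a b - slope a b'\<bar> \<le> r}"
            using sets_eq_imp_space_eq[OF sets(1)] by auto
          also have "\<dots> \<in> sets \<mu>" by measurable
          finally show "{a \<in> A. \<bar>slope a b - slope a b'\<bar> \<le> r} \<in> sets \<mu>" .
        qed
        finally show ?thesis using near[OF r b True] by simp
      qed simp
    qed
    also have "\<dots> = (\<Sum>j. \<integral>\<^sup>+b'. ennreal (\<kappa> * q ^ j) * indicator (cball b (2 ^ j * (2 * K * r))) b' \<partial>\<nu>)"
      by (intro nn_integral_suminf borel_measurable_times_ennreal borel_measurable_indicator) (auto simp: sets)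
    also have "\<dots> = (\<Sum>j. ennreal (\<kappa> * q ^ j) * emeasure \<nu> (cball b (2 ^ j * (2 * K * r))))"
      by (intro suminf_cong nn_integral_cmult_indicator) (simp add: sets)
    also have "\<dots> \<le> (\<Sum>j. ennreal ((\<kappa> * d * (2 * K) powr t * r powr t) * q' ^ j))"
    proof (intro suminf_le allI)
      fix j
      have "ennreal (\<kappa> * q ^ j) * emeasure \<nu> (cball b (2 ^ j * (2 * K * r)))
          \<le> ennreal (\<kappa> * q ^ j) * ennreal (d * (2 ^ j * (2 * K * r)) powr t)"
        using K r by (intro mult_left_mono \<nu>) auto
      also have "\<dots> = ennreal ((\<kappa> * q ^ j) * (d * (2 ^ j * (2 * K * r)) powr t))"
        using c \<kappa> by (simp add: ennreal_mult q_def)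
      also have "(\<kappa> * q ^ j) * (d * (2 ^ j * (2 * K * r)) powr t) = (\<kappa> * d * (2 * K) powr t * r powr t) * q' ^ j"
      proof -
        have "q' ^ j = q ^ j * (2 ^ j) powr t"
        proof -
          have "q' = q * 2 powr t" by (simp add: q'_def q_def powr_diff powr_divide)
          then show ?thesis
            by (simp add: power_mult_distrib powr_powr mult.commute flip: powr_realpow)
        qed
        then show ?thesis using K r by (simp add: powr_mult)
      qed
      finally show "ennreal (\<kappa> * q ^ j) * emeasure \<nu> (cball b (2 ^ j * (2 * K * r)))
          \<le> ennreal ((\<kappa> * d * (2 * K) powr t * r powr t) * q' ^ j)" .
    qed auto
    also have "\<dots> = ennreal (C * r powr t)"
      using \<kappa> c q' by (subst sum_ennreal_geometric) (auto simp: C_def)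
    finally show "(\<integral>\<^sup>+a. indicator A a * slope_count \<nu> B r a b \<partial>\<mu>) \<le> ennreal (C * r powr t)" .
  qed
qed

lemma slope_count_mono: "r \<le> r' \<Longrightarrow> slope_count \<nu> B r a b \<le> slope_count \<nu> B r' a b"
  unfolding slope_count_def by (intro nn_integral_mono) auto

text \<open>Weighting the count at radius 2^(-k) by 2^(k u) and summing gives a function
  \<open>F\<close> whose integral over \<open>A \<times> B\<close> is at most a convergent geometric
  series, since \<open>u < t\<close>. Hence \<open>F\<close> is finite almost everywhere there and
  some sublevel set has positive measure; a bound on the sum bounds the count at every dyadic
  radius.\<close>

lemma slope_count_good_set:
  assumes sets: "sets \<mu> = sets borel" "sets \<nu> = sets borel"
    and fin: "finite_measure \<mu>" "finite_measure \<nu>"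
    and AB: "A \<in> sets borel" "B \<in> sets borel" "A \<subseteq> base_points R" "B \<subseteq> off_points R"
    and pos: "0 < emeasure \<mu> A" "0 < emeasure \<nu> B"
    and R: "0 < R" and ust: "0 < u" "u < t" "t < s" and c: "0 \<le> c" "0 \<le> d"
    and \<mu>: "\<And>y r. 0 < r \<Longrightarrow> emeasure \<mu> (cball y r) \<le> ennreal (c * r powr s)"
    and \<nu>: "\<And>y r. 0 < r \<Longrightarrow> emeasure \<nu> (cball y r) \<le> ennreal (d * r powr t)"
  obtains G M where "G \<in> sets (\<mu> \<Otimes>\<^sub>M \<nu>)" "G \<subseteq> A \<times> B" "0 < emeasure (\<mu> \<Otimes>\<^sub>M \<nu>) G" "0 \<le> M"
    "\<And>a b r. (a, b) \<in> G \<Longrightarrow> 0 < r \<Longrightarrow> slope_count \<nu> B r a b \<le> ennreal (M * r powr u)"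
proof -
  note [measurable_cong] = sets
  note [measurable] = AB(1,2)
  interpret M: finite_measure \<mu> by (rule fin)
  interpret N: finite_measure \<nu> by (rule fin)
  interpret P: pair_sigma_finite \<mu> \<nu> ..
  have sp: "space \<mu> = UNIV" "space \<nu> = UNIV" 
    using sets_eq_imp_space_eq[OF sets(1)] sets_eq_imp_space_eq[OF sets(2)] by simp_all
  have spP: "space (\<mu> \<Otimes>\<^sub>M \<nu>) = UNIV" by (simp add: space_pair_measure sp)
  obtain C where C: "0 \<le> C"
    "\<And>r b. 0 < r \<Longrightarrow> b \<in> B \<Longrightarrow> (\<integral>\<^sup>+a. indicator A a * slope_count \<nu> B r a b \<partial>\<mu>) \<le> ennreal (C * r powr t)"
    using slope_count_integral[OF sets fin AB R _ ust(3) c \<mu> \<nu>] ust by auto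
  have meas [measurable]: "(\<lambda>p. slope_count \<nu> B r (fst p) (snd p)) \<in> borel_measurable (\<mu> \<Otimes>\<^sub>M \<nu>)" for r
    unfolding slope_count_def slope_def by measurable
  define F where "F p = (\<Sum>k. ennreal ((2 ^ k) powr u) * slope_count \<nu> B ((1 / 2) ^ k) (fst p) (snd p))" for p
  have F [measurable]: "F \<in> borel_measurable (\<mu> \<Otimes>\<^sub>M \<nu>)"
    unfolding F_def by measurable
  have AB_meas [measurable]: "A \<times> B \<in> sets (\<mu> \<Otimes>\<^sub>M \<nu>)" by (simp add: sets)
  define q where "q = (2 :: real) powr (u - t)"
  have q: "0 < q" "q < 1" using ust by (auto simp: q_def powr_less_one)
  define m where "m = measure \<nu> UNIV"
  have m: "emeasure \<nu> UNIV = ennreal m" "0 \<le> m"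
    by (simp_all add: m_def N.emeasure_eq_measure)
  have single: "(\<integral>\<^sup>+p. indicator (A \<times> B) p * slope_count \<nu> B r (fst p) (snd p) \<partial>(\<mu> \<Otimes>\<^sub>M \<nu>))
      \<le> ennreal (C * r powr t) * ennreal m" if r: "0 < r" for r
  proof -
    have "(\<integral>\<^sup>+p. indicator (A \<times> B) p * slope_count \<nu> B r (fst p) (snd p) \<partial>(\<mu> \<Otimes>\<^sub>M \<nu>))
        = (\<integral>\<^sup>+b. \<integral>\<^sup>+a. indicator (A \<times> B) (a, b) * slope_count \<nu> B r a b \<partial>\<mu> \<partial>\<nu>)"
      by (subst P.nn_integral_snd[symmetric]) (simp_all add: case_prod_unfold)
    also have "\<dots> \<le> (\<integral>\<^sup>+b. ennreal (C * r powr t) \<partial>\<nu>)"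
    proof (intro nn_integral_mono)
      fix b
      show "(\<integral>\<^sup>+a. indicator (A \<times> B) (a, b) * slope_count \<nu> B r a b \<partial>\<mu>) \<le> ennreal (C * r powr t)"
      proof (cases "b \<in> B")
        case True
        then show ?thesis using C(2)[OF r True] by (simp add: indicator_times)
      qed (simp add: indicator_times)
    qed
    also have "\<dots> = ennreal (C * r powr t) * ennreal m" by (simp add: sp m)
    finally show ?thesis .
  qed
  have "(\<integral>\<^sup>+p. indicator (A \<times> B) p * F p \<partial>(\<mu> \<Otimes>\<^sub>M \<nu>))
      = (\<integral>\<^sup>+p. (\<Sum>k. ennreal ((2 ^ k) powr u) * (indicator (A \<times> B) p * slope_count \<nu> B ((1 / 2) ^ k) (fst p) (snd p))) \<partial>(\<mu> \<Otimes>\<^sub>M \<nu>))"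
    unfolding F_def by (intro nn_integral_cong) (simp add: mult.left_commute flip: ennreal_suminf_cmult)
  also have "\<dots> = (\<Sum>k. ennreal ((2 ^ k) powr u) *
      (\<integral>\<^sup>+p. indicator (A \<times> B) p * slope_count \<nu> B ((1 / 2) ^ k) (fst p) (snd p) \<partial>(\<mu> \<Otimes>\<^sub>M \<nu>)))"
    by (subst nn_integral_suminf) (auto intro!: suminf_cong nn_integral_cmult)
  also have "\<dots> \<le> (\<Sum>k. ennreal ((C * m) * q ^ k))"
  proof (intro suminf_le allI)
    fix k
    have "ennreal ((2 ^ k) powr u) *
        (\<integral>\<^sup>+p. indicator (A \<times> B) p * slope_count \<nu> B ((1 / 2) ^ k) (fst p) (snd p) \<partial>(\<mu> \<Otimes>\<^sub>M \<nu>))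
        \<le> ennreal ((2 ^ k) powr u) * (ennreal (C * ((1 / 2) ^ k) powr t) * ennreal m)"
      by (intro mult_left_mono single) auto
    also have "\<dots> = ennreal ((2 ^ k) powr u * (C * ((1 / 2) ^ k) powr t * m))"
      using C m by (simp add: ennreal_mult)
    also have "(2 ^ k) powr u * (C * ((1 / 2) ^ k) powr t * m) = (C * m) * q ^ k"
    proof -
      have "q = 2 powr u * (1 / 2) powr t" by (simp add: q_def powr_diff powr_divide)
      then show ?thesis
        by (simp add: power_mult_distrib powr_powr mult.commute flip: powr_realpow)
    qed
    finally show "ennreal ((2 ^ k) powr u) *
        (\<integral>\<^sup>+p. indicator (A \<times> B) p * slope_count \<nu> B ((1 / 2) ^ k) (fst p) (snd p) \<partial>(\<mu> \<Otimes>\<^sub>M \<nu>))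
        \<le> ennreal ((C * m) * q ^ k)" .
  qed auto
  also have "\<dots> = ennreal (C * m / (1 - q))"
    using C m q by (intro sum_ennreal_geometric) auto
  finally have fin_F: "(\<integral>\<^sup>+p. indicator (A \<times> B) p * F p \<partial>(\<mu> \<Otimes>\<^sub>M \<nu>)) \<noteq> \<infinity>"
    by (metis ennreal_less_top infinity_ennreal_def le_less_trans less_irrefl)
  have AE: "AE p in \<mu> \<Otimes>\<^sub>M \<nu>. indicator (A \<times> B) p * F p \<noteq> \<infinity>"
    by (rule nn_integral_PInf_AE[OF _ fin_F]) measurable
  define G where "G k = {p \<in> A \<times> B. F p \<le> ennreal (real k)}" for k :: nat
  have G_meas: "G k \<in> sets (\<mu> \<Otimes>\<^sub>M \<nu>)" for k
  proof -
    have "G k = {p \<in> space (\<mu> \<Otimes>\<^sub>M \<nu>). p \<in> A \<times> B \<and> F p \<le> ennreal (real k)}"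
      by (auto simp: G_def spP)
    also have "\<dots> \<in> sets (\<mu> \<Otimes>\<^sub>M \<nu>)" by measurable
    finally show ?thesis .
  qed
  have "\<exists>k. 0 < emeasure (\<mu> \<Otimes>\<^sub>M \<nu>) (G k)"
  proof (rule ccontr)
    assume "\<nexists>k. 0 < emeasure (\<mu> \<Otimes>\<^sub>M \<nu>) (G k)"
    then have "G k \<in> null_sets (\<mu> \<Otimes>\<^sub>M \<nu>)" for k
      using G_meas by (auto simp: null_sets_def zero_less_iff_neq_zero)
    then have "(\<Union>k. G k) \<in> null_sets (\<mu> \<Otimes>\<^sub>M \<nu>)" by (rule null_sets_UN)
    then have "AE p in \<mu> \<Otimes>\<^sub>M \<nu>. p \<notin> (\<Union>k. G k)" by (rule AE_not_in)
    with AE have "AE p in \<mu> \<Otimes>\<^sub>M \<nu>. p \<notin> A \<times> B"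
    proof eventually_elim
      case (elim p)
      show ?case
      proof
        assume p: "p \<in> A \<times> B"
        then have "F p < top" using elim(1) by (simp add: less_top)
        then obtain x where x: "F p = ennreal x" "0 \<le> x" by (metis ennreal_cases less_irrefl)
        obtain k :: nat where "x \<le> real k" using real_arch_simple by blast
        then have "p \<in> G k" using p x by (simp add: G_def ennreal_leI)
        then show False using elim(2) by blast
      qed
    qed
    then have "emeasure (\<mu> \<Otimes>\<^sub>M \<nu>) {p \<in> space (\<mu> \<Otimes>\<^sub>M \<nu>). \<not> p \<notin> A \<times> B} = 0"
      by (rule AE_E2)
    then have "emeasure (\<mu> \<Otimes>\<^sub>M \<nu>) (A \<times> B) = 0" by (simp add: spP)
    then have "emeasure \<mu> A * emeasure \<nu> B = 0"
      using N.emeasure_pair_measure_Times[of A \<mu> B] AB sets by simp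
    then show False using pos by auto
  qed
  then obtain k where k: "0 < emeasure (\<mu> \<Otimes>\<^sub>M \<nu>) (G k)" ..
  \<comment> \<open>Rounding \<open>r\<close> up to a dyadic radius costs the factor
    \<open>2 powr u\<close>; for \<open>r > 1\<close> the total mass \<open>m\<close> of
    \<open>\<nu>\<close> is enough.\<close>
  define M where "M = max (2 powr u * real k) m"
  have M: "0 \<le> M" using m by (simp add: M_def max.coboundedI2)
  show ?thesis
  proof
    show "G k \<in> sets (\<mu> \<Otimes>\<^sub>M \<nu>)" by (rule G_meas)
    show "G k \<subseteq> A \<times> B" by (auto simp: G_def)
    show "0 < emeasure (\<mu> \<Otimes>\<^sub>M \<nu>) (G k)" by (rule k)
    show "0 \<le> M" by (rule M)
    fix a b r assume ab: "(a, b) \<in> G k" and r: "(0 :: real) < r"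
    show "slope_count \<nu> B r a b \<le> ennreal (M * r powr u)"
    proof (cases "r \<le> 1")
      case False
      have "slope_count \<nu> B r a b \<le> (\<integral>\<^sup>+b'. 1 \<partial>\<nu>)"
        unfolding slope_count_def by (intro nn_integral_mono) auto
      also have "\<dots> = ennreal m" using sp m by simp
      also have "\<dots> \<le> ennreal (M * r powr u)"
      proof (rule ennreal_leI)
        have "m \<le> M" by (simp add: M_def)
        also have "M * 1 \<le> M * r powr u"
          using False ust M by (intro mult_left_mono ge_one_powr_ge_zero) auto
        finally show "m \<le> M * r powr u" by simp
      qed
      finally show ?thesis .
    next
      case True
      have ex: "\<exists>i. (1 / 2) ^ Suc i < r"
      proof -
        obtain i where "(1 / 2) ^ i < r" using real_arch_pow_inv[OF r, of "1 / 2"] by auto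
        then have "(1 / 2) ^ Suc i < r" using r by (simp add: field_simps)
        then show ?thesis ..
      qed
      define i where "i = (LEAST i. (1 / 2) ^ Suc i < r)"
      have i1: "(1 / 2) ^ Suc i < r" unfolding i_def using ex by (rule LeastI_ex)
      have i2: "r \<le> (1 / 2) ^ i"
      proof (cases i)
        case 0
        then show ?thesis using True by simp
      next
        case (Suc k)
        then have "\<not> (1 / 2) ^ Suc k < r" unfolding i_def by (intro not_less_Least) simp
        then show ?thesis using Suc by simp
      qed
      have pw: "1 \<le> 2 powr u * r powr u * (2 ^ i) powr u"
      proof -
        have "1 \<le> 2 * r * 2 ^ i" using i1 by (simp add: field_simps power_divide)
        then have "1 \<le> (2 * r * 2 ^ i) powr u" using ust by (intro ge_one_powr_ge_zero) auto
        then show ?thesis using r by (simp add: powr_mult)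
      qed
      have "slope_count \<nu> B r a b \<le> ennreal (2 powr u * r powr u * (2 ^ i) powr u) * slope_count \<nu> B r a b"
        using mult_right_mono[OF ennreal_leI[OF pw], of "slope_count \<nu> B r a b"] by simp
      also have "\<dots> = ennreal (2 powr u * r powr u) * (ennreal ((2 ^ i) powr u) * slope_count \<nu> B r a b)"
        by (simp add: ennreal_mult mult.assoc)
      also have "\<dots> \<le> ennreal (2 powr u * r powr u) * F (a, b)"
      proof (rule mult_left_mono)
        have "ennreal ((2 ^ i) powr u) * slope_count \<nu> B r a b
            \<le> ennreal ((2 ^ i) powr u) * slope_count \<nu> B ((1 / 2) ^ i) a b"
          by (intro mult_left_mono slope_count_mono i2) auto
        also have "\<dots> \<le> F (a, b)"
          unfolding F_def
          using sum_le_suminf[of "\<lambda>k. ennreal ((2 ^ k) powr u) * slope_count \<nu> B ((1 / 2) ^ k) a b" "{i}"]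
          by simp
        finally show "ennreal ((2 ^ i) powr u) * slope_count \<nu> B r a b \<le> F (a, b)" .
      qed simp
      also have "\<dots> \<le> ennreal (2 powr u * r powr u) * ennreal (real k)"
        using ab by (intro mult_left_mono) (auto simp: G_def)
      also have "\<dots> = ennreal (2 powr u * real k * r powr u)"
        by (simp add: mult_ac flip: ennreal_mult)
      also have "\<dots> \<le> ennreal (M * r powr u)"
        by (intro ennreal_leI mult_right_mono) (auto simp: M_def)
      finally show ?thesis .
    qed
  qed
qed

section \<open>Lines in frame coordinates\<close>

definition join_line :: "real ^ 2 \<Rightarrow> real ^ 2 \<Rightarrow> (real ^ 2) set" where
  "join_line a b = affine hull {a, b}"

lemma join_line_affine_lines: "a \<noteq> b \<Longrightarrow> join_line a b \<in> affine_lines"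
  by (simp add: join_line_def affine_lines_def affine_affine_hull aff_dim_2)

lemma join_line_memb: "a \<in> join_line a b" "b \<in> join_line a b"
  by (simp_all add: join_line_def hull_inc)

text \<open>Here \<open>x\<close> is the foot of the perpendicular from the origin, hence the
  shortest vector on the line. Solving \<open>eta = 0\<close> along the line through
  \<open>x\<close> recovers the base point from foot and slope, and \<open>line_dist\<close>
  controls the foot and the direction.\<close>

lemma join_line_frame:
  assumes a: "eta a = 0" and b: "eta b \<noteq> 0"
  obtains W x where "subspace W" "dim W = 1" "x \<in> W\<^sup>\<bottom>" "join_line a b = (+) x ` W"
    "slope a b *\<^sub>R e + n \<in> W" "\<And>w. w \<in> W \<Longrightarrow> \<exists>k. w = k *\<^sub>R (slope a b *\<^sub>R e + n)"
    "xi a = xi x - slope a b * eta x" "norm x \<le> norm a"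
proof -
  define d where "d = slope a b *\<^sub>R e + n"
  have "a \<noteq> b" using a b by auto
  then obtain W x where W: "subspace W" "dim W = 1" "x \<in> W\<^sup>\<bottom>" "join_line a b = (+) x ` W"
    using join_line_affine_lines affine_lines_iff by blast
  obtain w1 w2 where w: "w1 \<in> W" "a = x + w1" "w2 \<in> W" "b = x + w2"
    using join_line_memb[of a b] join_line_memb[of b a] W(4) by (metis imageE join_line_memb)
  have xia: "(b - a) \<bullet> e = xi b - xi a" "(b - a) \<bullet> n = eta b"
    using a by (simp_all add: xi_def eta_def inner_diff_left)
  have "b - a = eta b *\<^sub>R d"
    using decomp[of "b - a"] b by (simp add: xia d_def slope_def scaleR_add_right)
  moreover have "b - a \<in> W" using w subspace_diff[OF W(1) w(3,1)] by simp
  ultimately have "(1 / eta b) *\<^sub>R (eta b *\<^sub>R d) \<in> W" using subspace_scale[OF W(1)] by metis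
  then have d: "d \<in> W" using b by simp
  have d_inner: "d \<bullet> e = slope a b" "d \<bullet> n = 1"
    by (simp_all add: d_def inner_add_left e_e n_e orth n_n)
  then have "d \<noteq> 0" by auto
  have "span {d} = W"
  proof (rule subspace_dim_equal)
    show "span {d} \<subseteq> W" using d W(1) by (simp add: span_minimal)
    show "dim W \<le> dim (span {d})" using \<open>d \<noteq> 0\<close> W(2) by (simp add: dim_span dim_singleton)
  qed (use W in auto)
  then have W_d: "\<exists>k. v = k *\<^sub>R d" if "v \<in> W" for v
    using that by (auto simp: span_singleton)
  obtain k where k: "w1 = k *\<^sub>R d" using W_d[OF w(1)] ..
  have ax: "a - p = (x - p) + k *\<^sub>R d" using w(2) k by simp
  have "xi a = xi x + k * slope a b" "eta a = eta x + k"
    unfolding xi_def eta_def ax by (simp_all only: inner_add_left inner_scaleR_left d_inner mult_1_right)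
  then have "xi a = xi x + k * slope a b" "k = - eta x" using a by simp_all
  then have "xi a = xi x - slope a b * eta x" by simp
  moreover have "norm x \<le> norm a"
  proof -
    have "orthogonal x w1" using W(3) w(1) by (simp add: orthogonal_comp_def orthogonal_commute)
    then have "(norm a)\<^sup>2 = (norm x)\<^sup>2 + (norm w1)\<^sup>2"
      unfolding w(2) by (rule norm_add_Pythagorean)
    then have "(norm x)\<^sup>2 \<le> (norm a)\<^sup>2" using zero_le_power2[of "norm w1"] by linarith
    then show ?thesis by (rule power2_le_imp_le) (rule norm_ge_zero)
  qed
  ultimately show ?thesis by (intro that[OF W d[unfolded d_def] W_d[unfolded d_def]])
qed

text \<open>With the slope bound \<open>S = 2 * R\<^sup>2\<close>, the slope changes by at most
  \<open>(1 + S)\<^sup>2\<close> times the line distance, which is the purpose of the 1 in the last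
  bracket. For the base point, \<open>1 + S\<close> accounts for the movement of the foot
  \<open>x\<close>, and \<open>R + 2 * norm p\<close>, a bound for
  \<open>\<bar>eta x'\<bar>\<close>, multiplies the change of slope.\<close>

definition lip_const :: "real \<Rightarrow> real" where
  "lip_const R = 1 + 2 * R\<^sup>2 + (1 + 2 * R\<^sup>2)\<^sup>2 * (1 + R + 2 * norm p)"

lemma slope_bound:
  assumes "0 < R" "a \<in> base_points R" "b \<in> off_points R"
  shows "\<bar>slope a b\<bar> \<le> 2 * R\<^sup>2"
proof -
  have b: "1 / R \<le> \<bar>eta b\<bar>" "\<bar>xi b - xi a\<bar> \<le> 2 * R"
    using assms by (auto simp: base_points_def off_points_def)
  have "0 < 1 / R" using assms by simp
  have "\<bar>slope a b\<bar> \<le> 2 * R / (1 / R)"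
    unfolding slope_def abs_divide using b \<open>0 < 1 / R\<close> by (intro frac_le) auto
  then show ?thesis by (simp add: power2_eq_square)
qed

text \<open>Base point and slope are Lipschitz functions of the line, so a set of lines of small
  diameter has small parameter sets. The operator norm is tested on the direction vector
  \<open>v'\<close> of the second line, the formula of \<open>join_line_frame\<close> then yields
  the base point.\<close>

lemma line_dist_lower:
  assumes R: "0 < R" and a: "a \<in> base_points R" "a' \<in> base_points R"
    and b: "b \<in> off_points R" "b' \<in> off_points R"
    and d: "line_dist (join_line a b) (join_line a' b') \<le> \<delta>"
  shows "\<bar>slope a b - slope a' b'\<bar> \<le> lip_const R * \<delta>" "\<bar>xi a - xi a'\<bar> \<le> lip_const R * \<delta>"
proof -
  define S where "S = 2 * R\<^sup>2"
  have "0 < 1 / R" using R by simp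
  then have nz: "eta a = 0" "eta b \<noteq> 0" "eta a' = 0" "eta b' \<noteq> 0"
    using a b by (auto simp: base_points_def off_points_def)
  define v v' where "v = slope a b *\<^sub>R e + n" and "v' = slope a' b' *\<^sub>R e + n"
  obtain W x where W: "subspace W" "dim W = 1" "x \<in> W\<^sup>\<bottom>" "join_line a b = (+) x ` W"
    "v \<in> W" "\<And>w. w \<in> W \<Longrightarrow> \<exists>k. w = k *\<^sub>R v" "xi a = xi x - slope a b * eta x"
    using join_line_frame[OF nz(1,2)] unfolding v_def by metis
  obtain W' x' where W': "subspace W'" "dim W' = 1" "x' \<in> W'\<^sup>\<bottom>" "join_line a' b' = (+) x' ` W'"
    "v' \<in> W'" "xi a' = xi x' - slope a' b' * eta x'" "norm x' \<le> norm a'"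
    using join_line_frame[OF nz(3,4)] unfolding v'_def by metis
  let ?D = "\<lambda>u. orth_proj W u - orth_proj W' u"
  have bl: "bounded_linear ?D"
    by (intro bounded_linear_sub bounded_linear_orth_proj W W')
  have "onorm ?D + norm (x - x') \<le> \<delta>"
    using d line_dist_eq[OF W(1-3) W'(1-3)] W(4) W'(4) by simp
  then have on: "onorm ?D \<le> \<delta>" and foot: "norm (x - x') \<le> \<delta>"
    using onorm_pos_le[OF bl] norm_ge_zero[of "x - x'"] by linarith+
  then have \<delta>: "0 \<le> \<delta>" using norm_ge_zero[of "x - x'"] by linarith
  have S: "\<bar>slope a b\<bar> \<le> S" "\<bar>slope a' b'\<bar> \<le> S" "0 \<le> S"
    unfolding S_def using slope_bound R a b by auto
  obtain k where k: "orth_proj W v' = k *\<^sub>R v" using W(6) orth_proj(1)[OF W(1)] by blast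
  have "orth_proj W' v' = v'"
    using W'(5) subspace_0[OF subspace_orthogonal_comp] by (intro orth_proj(3)[OF W'(1)]) auto
  then have "norm (k *\<^sub>R v - v') \<le> onorm ?D * norm v'"
    using onorm[OF bl, of v'] k by simp
  also have "\<dots> \<le> \<delta> * (1 + S)"
  proof (rule mult_mono[OF on _ \<delta>])
    have "norm v' \<le> norm (slope a' b' *\<^sub>R e) + norm n" unfolding v'_def by (rule norm_triangle_ineq)
    then show "norm v' \<le> 1 + S" using S by (simp add: norm_e norm_n)
  qed simp
  finally have kv: "norm (k *\<^sub>R v - v') \<le> \<delta> * (1 + S)" .
  \<comment> \<open>Both \<open>v\<close> and \<open>v'\<close> have \<open>n\<close>-component 1,
    so this combination of the two components of \<open>k *\<^sub>R v - v'\<close> eliminates the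
    unknown \<open>k\<close>.\<close>
  have sl_eq: "slope a b - slope a' b' = (k *\<^sub>R v - v') \<bullet> e - slope a b * ((k *\<^sub>R v - v') \<bullet> n)"
    by (simp add: v_def v'_def inner_diff_left inner_add_left e_e n_n n_e orth algebra_simps)
  have sl: "\<bar>slope a b - slope a' b'\<bar> \<le> (1 + S)\<^sup>2 * \<delta>"
  proof -
    have "\<bar>slope a b * ((k *\<^sub>R v - v') \<bullet> n)\<bar> \<le> S * norm (k *\<^sub>R v - v')"
      unfolding abs_mult using S inner_le_norm by (intro mult_mono) auto
    then have "\<bar>slope a b - slope a' b'\<bar> \<le> (1 + S) * norm (k *\<^sub>R v - v')"
      using sl_eq inner_le_norm(1)[of "k *\<^sub>R v - v'"] by (simp add: distrib_right)
    also have "\<dots> \<le> (1 + S) * (\<delta> * (1 + S))" using kv S by (intro mult_left_mono) auto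
    finally show ?thesis by (simp add: power2_eq_square mult_ac)
  qed
  have L: "lip_const R = 1 + S + (1 + S)\<^sup>2 * (1 + R + 2 * norm p)"
    by (simp add: lip_const_def S_def)
  have "(1 + S)\<^sup>2 * 1 \<le> (1 + S)\<^sup>2 * (1 + R + 2 * norm p)"
    using R by (intro mult_left_mono) auto
  then have "(1 + S)\<^sup>2 \<le> lip_const R" unfolding L using S by linarith
  then show "\<bar>slope a b - slope a' b'\<bar> \<le> lip_const R * \<delta>"
    using sl \<delta> mult_right_mono by (metis order_trans)
  have "\<bar>eta x'\<bar> \<le> R + 2 * norm p"
  proof -
    have "\<bar>eta x'\<bar> \<le> norm (x' - p)" by (simp add: eta_def inner_le_norm)
    also have "\<dots> \<le> norm x' + norm p" by (rule norm_triangle_ineq4)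
    also have "norm x' \<le> norm (a' - p) + norm p"
      using W'(7) norm_triangle_ineq[of "a' - p" p] by simp
    also have "norm (a' - p) \<le> R"
      using dist_le_frame[of a' p] a(2) by (simp add: base_points_def dist_norm xi_def eta_def)
    finally show ?thesis by simp
  qed
  then have p3: "\<bar>(slope a b - slope a' b') * eta x'\<bar> \<le> ((1 + S)\<^sup>2 * \<delta>) * (R + 2 * norm p)"
    unfolding abs_mult using sl by (intro mult_mono) auto
  have p1: "\<bar>(x - x') \<bullet> e\<bar> \<le> \<delta>" and p2: "\<bar>slope a b * ((x - x') \<bullet> n)\<bar> \<le> S * \<delta>"
    using inner_le_norm[of "x - x'"] foot S unfolding abs_mult
    by (auto intro!: mult_mono)
  have "xi a - xi a' = (x - x') \<bullet> e - slope a b * ((x - x') \<bullet> n) - (slope a b - slope a' b') * eta x'"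
    unfolding W(7) W'(6) by (simp add: xi_def eta_def inner_diff_left algebra_simps)
  then have "\<bar>xi a - xi a'\<bar> \<le> \<delta> + S * \<delta> + ((1 + S)\<^sup>2 * \<delta>) * (R + 2 * norm p)"
    using p1 p2 p3 by linarith
  also have "\<dots> \<le> lip_const R * \<delta>"
    using \<delta> by (simp add: L algebra_simps)
  finally show "\<bar>xi a - xi a'\<bar> \<le> lip_const R * \<delta>" .
qed

section \<open>Lines spanned by the set\<close>

text \<open>Mass distribution on the good set \<open>G\<close>: close to a fixed line the base point
  lies in a ball of radius comparable to the diameter, which yields the power \<open>s\<close>, and
  over each base point the slopes lie in an interval of comparable length, which yields the power
  \<open>u\<close>. A cover with too small a sum would not exhaust the mass of
  \<open>G\<close>.\<close>

lemma hausdorff_measure_spanned_lines_pos: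
  assumes sets: "sets \<mu> = sets borel" "sets \<nu> = sets borel"
    and fin: "finite_measure \<mu>" "finite_measure \<nu>"
    and AB: "A \<in> sets borel" "B \<in> sets borel" "A \<subseteq> base_points R" "B \<subseteq> off_points R"
    and X: "A \<subseteq> X" "B \<subseteq> X"
    and pos: "0 < emeasure \<mu> A" "0 < emeasure \<nu> B"
    and R: "0 < R" and ust: "0 < u" "u < t" "t < s" and c: "0 \<le> c" "0 \<le> d"
    and \<mu>: "\<And>y r. 0 < r \<Longrightarrow> emeasure \<mu> (cball y r) \<le> ennreal (c * r powr s)"
    and \<nu>: "\<And>y r. 0 < r \<Longrightarrow> emeasure \<nu> (cball y r) \<le> ennreal (d * r powr t)"
  shows "hausdorff_measure line_metric (s + u) (spanned_lines X) \<noteq> 0"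
proof
  assume null: "hausdorff_measure line_metric (s + u) (spanned_lines X) = 0"
  note [measurable_cong] = sets
  interpret M: finite_measure \<mu> by (rule fin)
  interpret N: finite_measure \<nu> by (rule fin)
  interpret P: pair_sigma_finite \<mu> \<nu> ..
  have sp: "space \<mu> = UNIV" "space \<nu> = UNIV"
    using sets_eq_imp_space_eq[OF sets(1)] sets_eq_imp_space_eq[OF sets(2)] by simp_all
  have spP: "space (\<mu> \<Otimes>\<^sub>M \<nu>) = UNIV" by (simp add: space_pair_measure sp)
  let ?P = "emeasure (\<mu> \<Otimes>\<^sub>M \<nu>)"
  obtain G M where G: "G \<in> sets (\<mu> \<Otimes>\<^sub>M \<nu>)" "G \<subseteq> A \<times> B" "0 < ?P G" "0 \<le> M"
    "\<And>a b r. (a, b) \<in> G \<Longrightarrow> 0 < r \<Longrightarrow> slope_count \<nu> B r a b \<le> ennreal (M * r powr u)"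
    using slope_count_good_set[OF sets fin AB pos R ust c \<mu> \<nu>] by blast
  note [measurable] = G(1)
  define L where "L = lip_const R"
  have L: "0 < L" using R unfolding L_def lip_const_def
    by (intro add_pos_nonneg mult_nonneg_nonneg) auto
  define K where "K = c * L powr s * (M * (2 * L) powr u)"
  have K: "0 \<le> K" using c G(4) by (simp add: K_def)
  \<comment> \<open>The members \<open>U\<close> of a cover are arbitrary, so the pairs whose line
    lies in \<open>U\<close> need not form a measurable set; they are enclosed in a measurable
    \<open>Z\<close>.\<close>
  have bound: "\<exists>Z\<in>sets (\<mu> \<Otimes>\<^sub>M \<nu>). {(a, b) \<in> G. join_line a b \<in> U} \<subseteq> Z \<and>
      ?P Z \<le> ennreal K * diam_powr line_metric (s + u) U"
    if U: "U \<subseteq> affine_lines" "ediameter line_metric U \<le> ennreal 1" for U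
  proof (cases "{(a, b) \<in> G. join_line a b \<in> U} = {}")
    case True
    then show ?thesis by (intro bexI[of _ "{}"]) auto
  next
    case False
    then obtain a0 b0 where ab0: "(a0, b0) \<in> G" "join_line a0 b0 \<in> U" by auto
    define \<delta> where "\<delta> = enn2real (ediameter line_metric U)"
    have fin_diam: "ediameter line_metric U < top"
      using U(2) ennreal_less_top le_less_trans by blast
    have dist: "line_dist l l' \<le> \<delta>" if "l \<in> U" "l' \<in> U" for l l'
    proof -
      have "ennreal (line_dist l l') \<le> ediameter line_metric U"
        unfolding ediameter_def mdist_line_metric[symmetric] using that by (blast intro: SUP_upper2)
      then have "enn2real (ennreal (line_dist l l')) \<le> \<delta>"
        unfolding \<delta>_def by (intro enn2real_mono fin_diam)
      moreover have "0 \<le> line_dist l l'"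
        using Metric_space.nonneg[OF Metric_space_lines] .
      ultimately show ?thesis by simp
    qed
    define Z where "Z = {p \<in> G. \<bar>xi (fst p) - xi a0\<bar> \<le> L * \<delta> \<and> \<bar>slope (fst p) (snd p) - slope a0 b0\<bar> \<le> L * \<delta>}"
    have Z: "Z \<in> sets (\<mu> \<Otimes>\<^sub>M \<nu>)"
    proof -
      have "Z = {p \<in> space (\<mu> \<Otimes>\<^sub>M \<nu>). p \<in> G \<and> \<bar>xi (fst p) - xi a0\<bar> \<le> L * \<delta> \<and>
          \<bar>(xi (snd p) - xi (fst p)) / eta (snd p) - slope a0 b0\<bar> \<le> L * \<delta>}"
        by (auto simp: Z_def spP slope_def)
      also have "\<dots> \<in> sets (\<mu> \<Otimes>\<^sub>M \<nu>)" by measurable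
      finally show ?thesis .
    qed
    have sub: "{(a, b) \<in> G. join_line a b \<in> U} \<subseteq> Z"
    proof
      fix p assume "p \<in> {(a, b) \<in> G. join_line a b \<in> U}"
      then obtain a b where p: "p = (a, b)" "(a, b) \<in> G" "join_line a b \<in> U" by auto
      have "a \<in> base_points R" "a0 \<in> base_points R" "b \<in> off_points R" "b0 \<in> off_points R"
        using p ab0 G(2) AB by auto
      from line_dist_lower[OF R this dist[OF p(3) ab0(2)]] show "p \<in> Z"
        using p by (simp add: Z_def L_def)
    qed
    \<comment> \<open>The diameter \<open>\<delta>\<close> may be 0, whereas the ball estimates need
      a positive radius; \<open>r > \<delta>\<close> is used first and then tends to
      \<open>\<delta>\<close>.\<close>
    have Z_le: "?P Z \<le> ennreal (K * r powr (s + u))" if r: "\<delta> < r" for r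
    proof -
      have "0 \<le> \<delta>" by (simp add: \<delta>_def)
      then have r0: "0 < r" using r by simp
      have fibre: "emeasure \<nu> (Pair a -` Z) \<le> ennreal (M * (2 * L * r) powr u) * indicator (cball a0 (L * r)) a" for a
      proof (cases "Pair a -` Z = {}")
        case True
        then show ?thesis by simp
      next
        case False
        \<comment> \<open>The slope window is recentred at a point \<open>b1\<close> of the same
          fibre, because the count is controlled only at pairs of \<open>G\<close>; this doubles the
          radius.\<close>
        then obtain b1 where b1: "(a, b1) \<in> Z" by auto
        then have "eta a = 0" "eta a0 = 0" "\<bar>xi a - xi a0\<bar> \<le> L * \<delta>"
          using ab0 G(2) AB by (auto simp: Z_def base_points_def)
        then have "dist a0 a \<le> L * \<delta>" using xi_dist[of a a0] by (simp add: dist_commute)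
        also have "L * \<delta> \<le> L * r" using L r by simp
        finally have a: "a \<in> cball a0 (L * r)" by simp
        have "emeasure \<nu> (Pair a -` Z) = (\<integral>\<^sup>+b. indicator (Pair a -` Z) b \<partial>\<nu>)"
          using sets_Pair1[OF Z] by simp
        also have "\<dots> \<le> slope_count \<nu> B (2 * L * r) a b1"
          unfolding slope_count_def
        proof (intro nn_integral_mono)
          fix b
          have "b \<in> B \<and> \<bar>slope a b1 - slope a b\<bar> \<le> 2 * L * r" if "(a, b) \<in> Z"
          proof
            show "b \<in> B" using that G(2) by (auto simp: Z_def)
            have "\<bar>slope a b1 - slope a b\<bar> \<le> 2 * (L * \<delta>)"
              using b1 that unfolding Z_def mem_Collect_eq fst_conv snd_conv by linarith
            also have "\<dots> \<le> 2 * (L * r)" using L r by simp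
            finally show "\<bar>slope a b1 - slope a b\<bar> \<le> 2 * L * r" by simp
          qed
          then show "indicator (Pair a -` Z) b
              \<le> (if b \<in> B \<and> \<bar>slope a b1 - slope a b\<bar> \<le> 2 * L * r then 1 else 0 :: ennreal)"
            by (auto simp: indicator_def)
        qed
        also have "\<dots> \<le> ennreal (M * (2 * L * r) powr u)"
          using b1 L r0 by (intro G(5)) (auto simp: Z_def)
        finally show ?thesis using a by simp
      qed
      have "?P Z = (\<integral>\<^sup>+a. emeasure \<nu> (Pair a -` Z) \<partial>\<mu>)"
        by (rule N.emeasure_pair_measure_alt[OF Z])
      also have "\<dots> \<le> (\<integral>\<^sup>+a. ennreal (M * (2 * L * r) powr u) * indicator (cball a0 (L * r)) a \<partial>\<mu>)"
        by (intro nn_integral_mono fibre)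
      also have "\<dots> = ennreal (M * (2 * L * r) powr u) * emeasure \<mu> (cball a0 (L * r))"
        by (rule nn_integral_cmult_indicator) (simp add: sets)
      also have "\<dots> \<le> ennreal (M * (2 * L * r) powr u) * ennreal (c * (L * r) powr s)"
        using L r0 by (intro mult_left_mono \<mu>) auto
      also have "\<dots> = ennreal ((M * (2 * L * r) powr u) * (c * (L * r) powr s))"
        using G(4) c by (simp add: ennreal_mult)
      also have "(M * (2 * L * r) powr u) * (c * (L * r) powr s) = K * r powr (s + u)"
        using L r0 by (simp add: K_def powr_mult powr_add)
      finally show ?thesis .
    qed
    have "((\<lambda>r. ennreal (K * r powr (s + u))) \<longlongrightarrow> ennreal (K * \<delta> powr (s + u))) (at_right \<delta>)"
      using ust by (intro tendsto_ennrealI tendsto_mult tendsto_const tendsto_powr2 tendsto_ident_at)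
        (auto simp: eventually_at_filter \<delta>_def
          intro!: always_eventually order_trans[OF enn2real_nonneg less_imp_le])
    then have "?P Z \<le> ennreal (K * \<delta> powr (s + u))"
      by (rule tendsto_lowerbound) (auto simp: eventually_at_filter intro!: always_eventually Z_le)
    also have "\<dots> = ennreal K * diam_powr line_metric (s + u) U"
      using ab0 ust K by (auto simp: diam_powr_def \<delta>_def ennreal_mult)
    finally show ?thesis using Z sub by blast
  qed
  \<comment> \<open>\<open>K\<close> is only known to be nonnegative, hence the division by
    \<open>K + 1\<close>.\<close>
  define \<epsilon> where "\<epsilon> = ?P G / ennreal (K + 1)"
  have \<epsilon>: "0 < \<epsilon>" using G(3) by (simp add: \<epsilon>_def ennreal_zero_less_divide)
  obtain U :: "nat \<Rightarrow> (real ^ 2) set set" where U: "spanned_lines X \<subseteq> (\<Union>i. U i)"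
    "\<And>i. U i \<subseteq> mspace line_metric" "\<And>i. ediameter line_metric (U i) \<le> ennreal 1"
    "(\<Sum>i. diam_powr line_metric (s + u) (U i)) < \<epsilon>"
    by (rule hausdorff_measure_eq_0D[OF null zero_less_one \<epsilon>], rule that) auto
  have "\<forall>i. \<exists>Z. Z \<in> sets (\<mu> \<Otimes>\<^sub>M \<nu>) \<and> {(a, b) \<in> G. join_line a b \<in> U i} \<subseteq> Z \<and>
      ?P Z \<le> ennreal K * diam_powr line_metric (s + u) (U i)"
    using bound[of "U _"] U(2,3) unfolding mspace_line_metric Bex_def by blast
  from choice[OF this] obtain Z where Z': "\<forall>i. Z i \<in> sets (\<mu> \<Otimes>\<^sub>M \<nu>) \<and>
      {(a, b) \<in> G. join_line a b \<in> U i} \<subseteq> Z i \<and>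
      ?P (Z i) \<le> ennreal K * diam_powr line_metric (s + u) (U i)" ..
  have Z: "Z i \<in> sets (\<mu> \<Otimes>\<^sub>M \<nu>)" "{(a, b) \<in> G. join_line a b \<in> U i} \<subseteq> Z i"
    "?P (Z i) \<le> ennreal K * diam_powr line_metric (s + u) (U i)" for i
    using spec[OF Z', of i] by simp_all
  have "G \<subseteq> (\<Union>i. Z i)"
  proof
    fix p assume "p \<in> G"
    then obtain a b where p: "p = (a, b)" "(a, b) \<in> G" by (cases p) auto
    have ab: "a \<in> A" "b \<in> B" using p G(2) by auto
    then have "eta a = 0" "1 / R \<le> \<bar>eta b\<bar>" using AB by (auto simp: base_points_def off_points_def)
    moreover have "0 < 1 / R" using R by simp
    ultimately have "a \<noteq> b" by auto
    then have "join_line a b \<in> spanned_lines X"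
      using join_line_affine_lines join_line_memb ab X unfolding spanned_lines_def by blast
    then obtain i where "join_line a b \<in> U i" using U(1) by blast
    then have "p \<in> Z i" using Z(2)[of i] p by auto
    then show "p \<in> (\<Union>i. Z i)" by blast
  qed
  then have "?P G \<le> ?P (\<Union>i. Z i)" using Z(1) by (intro emeasure_mono) auto
  also have "\<dots> \<le> (\<Sum>i. ?P (Z i))" using Z(1) by (intro emeasure_subadditive_countably) auto
  also have "\<dots> \<le> (\<Sum>i. ennreal K * diam_powr line_metric (s + u) (U i))"
    using Z(3) by (intro suminf_le) auto
  also have "\<dots> = ennreal K * (\<Sum>i. diam_powr line_metric (s + u) (U i))" by simp
  also have "\<dots> \<le> ennreal (K + 1) * (\<Sum>i. diam_powr line_metric (s + u) (U i))"
    by (intro mult_right_mono ennreal_leI) auto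
  also have "\<dots> < ennreal (K + 1) * \<epsilon>"
    using K by (intro ennreal_mult_strict_left_mono U(4)) (simp_all del: ennreal_plus)
  also have "\<dots> = ?P G"
    unfolding \<epsilon>_def ennreal_times_divide mult.commute[of "ennreal (K + 1)"]
    using K by (intro ennreal_mult_divide_eq) (simp_all del: ennreal_plus)
  finally show False by simp
qed

end

section \<open>Frames, exhaustion and choice of exponents\<close>

lemma affine_line_frame:
  assumes "l \<in> affine_lines"
  obtains p e n where "line_frame e n" "l = {b. line_frame.eta p n b = 0}"
proof -
  obtain W p where W: "subspace W" "dim W = 1" "l = (+) p ` W"
    using assms affine_lines_iff by blast
  have "W \<noteq> {0}" using W(2) by auto
  then obtain w where w: "w \<in> W" "w \<noteq> 0" using subspace_0[OF W(1)] by blast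
  define e where "e = (1 / norm w) *\<^sub>R w"
  \<comment> \<open>A quarter turn of \<open>e\<close>; the expansion \<open>decomp\<close> then
    reduces to \<open>ee\<close>.\<close>
  define n :: "real ^ 2" where "n = (\<chi> i. if i = 1 then - e $ 2 else e $ 1)"
  have e: "norm e = 1" "e \<in> W" using w subspace_scale[OF W(1)] by (auto simp: e_def)
  have ee: "(e $ 1)\<^sup>2 + (e $ 2)\<^sup>2 = 1"
    using e(1) by (simp add: norm_eq_1 inner_vec_def sum_2 power2_eq_square)
  have n: "n $ 1 = - e $ 2" "n $ 2 = e $ 1" by (simp_all add: n_def)
  interpret line_frame p e n
  proof
    show "norm e = 1" by (rule e)
    show "norm n = 1"
      using ee by (simp add: norm_eq_1 inner_vec_def sum_2 power2_eq_square n add.commute)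
    show "e \<bullet> n = 0" by (simp add: inner_vec_def sum_2 n)
    fix v :: "real ^ 2"
    have "v $ 1 = v $ 1 * ((e $ 1)\<^sup>2 + (e $ 2)\<^sup>2)" "v $ 2 = v $ 2 * ((e $ 1)\<^sup>2 + (e $ 2)\<^sup>2)"
      by (simp_all add: ee)
    then show "v = (v \<bullet> e) *\<^sub>R e + (v \<bullet> n) *\<^sub>R n"
      by (simp add: vec_eq_iff forall_2 inner_vec_def sum_2 n power2_eq_square algebra_simps)
  qed
  have "span {e} = W"
  proof (rule subspace_dim_equal)
    show "span {e} \<subseteq> W" using e(2) W(1) by (simp add: span_minimal)
    show "dim W \<le> dim (span {e})" using e(1) W(2) by (auto simp: dim_span dim_singleton)
  qed (use W in auto)
  then have W_e: "v \<in> W \<longleftrightarrow> (\<exists>k. v = k *\<^sub>R e)" for v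
    by (auto simp: span_singleton)
  have "l = {b. eta b = 0}"
  proof (intro equalityI subsetI)
    fix b assume "b \<in> l"
    then obtain v where "v \<in> W" "b = p + v" using W(3) by blast
    then show "b \<in> {b. eta b = 0}" using W_e[of v] by (auto simp: eta_def orth)
  next
    fix b assume "b \<in> {b. eta b = 0}"
    then have "b - p = ((b - p) \<bullet> e) *\<^sub>R e" using decomp[of "b - p"] by (simp add: eta_def)
    then have "b - p \<in> W" using W_e by blast
    then have "p + (b - p) \<in> l" unfolding W(3) by blast
    then show "b \<in> l" by simp
  qed
  then show ?thesis using that line_frame_axioms by blast
qed

text \<open>This allows passing to bounded pieces of a set of full measure. Positivity from some
  index on, rather than at one index, lets a common index serve two measures.\<close>

lemma emeasure_pos_increasing:
  assumes sets: "sets \<mu> = sets borel" and pos: "0 < emeasure \<mu> UNIV" and E: "- E \<in> null_sets \<mu>"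
    and A: "\<And>n. A n \<in> sets borel" "incseq A" "E \<subseteq> (\<Union>n. A n)"
  obtains k where "\<And>n. k \<le> n \<Longrightarrow> 0 < emeasure \<mu> (A n)"
proof -
  have "\<exists>k. 0 < emeasure \<mu> (A k)"
  proof (rule ccontr)
    assume "\<nexists>k. 0 < emeasure \<mu> (A k)"
    then have "A k \<in> null_sets \<mu>" for k
      using A(1) sets by (auto simp: null_sets_def zero_less_iff_neq_zero)
    then have "(\<Union>k. A k) \<union> - E \<in> null_sets \<mu>" using E by (intro null_sets.Un null_sets_UN)
    moreover have "(\<Union>k. A k) \<union> - E = UNIV" using A(3) by blast
    ultimately show False using pos by (simp add: null_sets_def)
  qed
  then obtain k where "0 < emeasure \<mu> (A k)" ..
  moreover have "emeasure \<mu> (A k) \<le> emeasure \<mu> (A n)" if "k \<le> n" for n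
    using that A sets by (intro emeasure_mono) (auto simp: incseq_def)
  ultimately show ?thesis using that by (meson less_le_trans)
qed

text \<open>If the bound failed, the family of lines would be null for some exponent
  \<open>s0\<close> below the claimed one. The slack is divided between an \<open>s\<close> below
  the dimension of \<open>X\<close>, for the base points, and a \<open>u\<close> below
  \<open>t\<close>, for the slopes, with \<open>s + u \<ge> s0\<close>.\<close>

theorem theorem1p9:
  fixes X :: "(real^2) set" and t :: real
  assumes "X \<in> sets borel"
    and "\<exists>l'\<in>affine_lines.
           hausdorff_dim euclidean_metric (X - l') < hausdorff_dim euclidean_metric X"
    and "0 < t" and "ennreal t < hausdorff_dim euclidean_metric X"
    and "\<forall>l\<in>affine_lines. ennreal t \<le> hausdorff_dim euclidean_metric (X - l)"
  shows "hausdorff_dim line_metric (spanned_lines X) \<ge> hausdorff_dim euclidean_metric X + ennreal t"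
proof (rule ccontr)
  let ?dim = "hausdorff_dim euclidean_metric"
  assume "\<not> ?thesis"
  then have "hausdorff_dim line_metric (spanned_lines X) < ?dim X + ennreal t" by simp
  then obtain s0 where s0: "0 \<le> s0" "hausdorff_measure line_metric s0 (spanned_lines X) = 0"
    "ennreal s0 < ?dim X + ennreal t"
    unfolding hausdorff_dim_def[of line_metric] INF_less_iff by auto
  obtain l where l: "l \<in> affine_lines" "?dim (X - l) < ?dim X" using assms(2) by blast
  \<comment> \<open>If \<open>s0 < t\<close>, then \<open>ennreal (s0 - t)\<close> is 0 by
    truncation and the claim is that \<open>X\<close> has positive dimension.\<close>
  have "ennreal (s0 - t) < ?dim X"
  proof (rule ccontr)
    assume "\<not> ?thesis"
    then have dim: "?dim X \<le> ennreal (s0 - t)" by simp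
    have "t \<le> s0"
    proof (rule ccontr)
      assume "\<not> t \<le> s0"
      then have "ennreal (s0 - t) = 0" by (simp add: ennreal_neg)
      then show False using dim assms(4) by simp
    qed
    have "?dim X + ennreal t \<le> ennreal (s0 - t) + ennreal t" using dim by (rule add_right_mono)
    also have "\<dots> = ennreal s0" using \<open>t \<le> s0\<close> assms(3) by (simp flip: ennreal_plus)
    finally show False using s0(3) by simp
  qed
  \<comment> \<open>Three demands on \<open>s\<close>: the remainder \<open>s0 - s\<close> must stay
    below \<open>t\<close>, Kaufman's series needs an exponent above \<open>t\<close>, and exceeding
    the dimension of \<open>X - l\<close> makes that part null.\<close>
  then have "max (ennreal (s0 - t)) (max (ennreal t) (?dim (X - l))) < ?dim X"
    using assms(4) l(2) by simp
  then obtain y where y: "max (ennreal (s0 - t)) (max (ennreal t) (?dim (X - l))) < y" "y < ?dim X"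
    using dense by blast
  then obtain s where s: "y = ennreal s" "0 \<le> s"
    by (metis ennreal_cases not_top_less)
  have st: "s0 - t < s" "t < s" "?dim (X - l) < ennreal s" "ennreal s < ?dim X"
  proof -
    have "ennreal (s0 - t) < ennreal s" "ennreal t < ennreal s" using y(1) s(1) by auto
    then show "s0 - t < s" "t < s"
      using ennreal_leI[of s "s0 - t"] ennreal_leI[of s t] by (meson not_le)+
    show "?dim (X - l) < ennreal s" "ennreal s < ?dim X" using y s(1) by auto
  qed
  \<comment> \<open>The entry \<open>t / 2\<close> keeps \<open>u\<close> positive when
    \<open>s\<close> alone reaches \<open>s0\<close>. The Frostman exponent \<open>t1\<close> on
    \<open>X - l\<close> lies below \<open>t\<close> to guarantee nonzero measure, and above
    \<open>u\<close> to pay for the sum over dyadic radii.\<close>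
  define u where "u = max (t / 2) (s0 - s)"
  define t1 where "t1 = (u + t) / 2"
  have u: "0 < u" "u < t" "s0 \<le> s + u" using st assms(3) by (auto simp: u_def)
  have t1: "u < t1" "t1 < t" "0 < t1" "t1 < s" using u st by (auto simp: t1_def)
  obtain p e n where frame: "line_frame e n" and l_eta: "l = {b. line_frame.eta p n b = 0}"
    using affine_line_frame[OF l(1)] .
  interpret line_frame p e n by (rule frame)
  have l_meas: "l \<in> sets borel"
  proof -
    have "l = {b \<in> space borel. eta b = 0}" using l_eta by simp
    also have "\<dots> \<in> sets borel" by measurable
    finally show ?thesis .
  qed
  have Xl: "X \<inter> l \<in> sets borel" "X - l \<in> sets borel" using assms(1) l_meas by auto
  have s_pos: "0 < s" using st(2) assms(3) by simp
  \<comment> \<open>\<open>X - l\<close> is null for the exponent \<open>s\<close>, so a null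
    \<open>X \<inter> l\<close> would make \<open>X\<close> null for an exponent below its
    dimension.\<close>
  have nz: "hausdorff_measure euclidean_metric s (X \<inter> l) \<noteq> 0"
  proof
    assume "hausdorff_measure euclidean_metric s (X \<inter> l) = 0"
    then have "hausdorff_measure euclidean_metric s ((X \<inter> l) \<union> (X - l)) = 0"
      using hausdorff_measure_eq_0[OF st(3)] st(2) assms(3) by (intro hausdorff_measure_eq_0_Un) auto
    then show False using hausdorff_measure_neq_0[OF st(4) s(2)] by (simp add: Int_Diff_Un)
  qed
  obtain \<mu> c where \<mu>: "sets \<mu> = sets borel" "finite_measure \<mu>" "0 < emeasure \<mu> UNIV"
    "- (X \<inter> l) \<in> null_sets \<mu>" "0 \<le> c"
    "\<And>y r. 0 < r \<Longrightarrow> emeasure \<mu> (cball y r) \<le> ennreal (c * r powr s)"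
    by (rule frostman[OF Xl(1) s_pos nz], rule that) auto
  have "ennreal t1 < ?dim (X - l)"
    using t1 assms(3,5) l(1) by (metis ennreal_lessI order_less_le_trans)
  then have nz': "hausdorff_measure euclidean_metric t1 (X - l) \<noteq> 0"
    using t1 by (intro hausdorff_measure_neq_0) auto
  obtain \<nu> d where \<nu>: "sets \<nu> = sets borel" "finite_measure \<nu>" "0 < emeasure \<nu> UNIV"
    "- (X - l) \<in> null_sets \<nu>" "0 \<le> d"
    "\<And>y r. 0 < r \<Longrightarrow> emeasure \<nu> (cball y r) \<le> ennreal (d * r powr t1)"
    by (rule frostman[OF Xl(2) t1(3) nz'], rule that) auto
  have base_meas: "base_points R \<in> sets borel" and off_meas: "off_points R \<in> sets borel" for R
  proof -
    have "{a \<in> space borel. eta a = 0 \<and> \<bar>xi a\<bar> \<le> R} \<in> sets borel" by measurable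
    then show "base_points R \<in> sets borel" by (simp add: base_points_def)
    have "{b \<in> space borel. 1 / R \<le> \<bar>eta b\<bar> \<and> \<bar>eta b\<bar> \<le> R \<and> \<bar>xi b\<bar> \<le> R} \<in> sets borel" by measurable
    then show "off_points R \<in> sets borel" by (simp add: off_points_def)
  qed
  \<comment> \<open>\<open>Suc k\<close> keeps the radius \<open>R\<close> positive.\<close>
  define A where "A k = X \<inter> l \<inter> base_points (Suc k)" for k
  define B where "B k = (X - l) \<inter> off_points (Suc k)" for k
  obtain k1 where k1: "\<And>k. k1 \<le> k \<Longrightarrow> 0 < emeasure \<mu> (A k)"
  proof (rule emeasure_pos_increasing[OF \<mu>(1,3,4)])
    show "A k \<in> sets borel" for k
      unfolding A_def using assms(1) l_meas base_meas by auto
    show "incseq A" by (force simp: incseq_def A_def base_points_def)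
    show "X \<inter> l \<subseteq> (\<Union>k. A k)"
    proof
      fix a assume a: "a \<in> X \<inter> l"
      obtain k :: nat where "\<bar>xi a\<bar> \<le> k" using real_arch_simple by blast
      then have "a \<in> A k" using a l_eta by (auto simp: A_def base_points_def)
      then show "a \<in> (\<Union>k. A k)" by blast
    qed
  next
    fix k assume "\<And>j. k \<le> j \<Longrightarrow> 0 < emeasure \<mu> (A j)"
    then show thesis by (rule that)
  qed
  obtain k2 where k2: "\<And>k. k2 \<le> k \<Longrightarrow> 0 < emeasure \<nu> (B k)"
  proof (rule emeasure_pos_increasing[OF \<nu>(1,3,4)])
    show "B k \<in> sets borel" for k
      unfolding B_def using assms(1) l_meas off_meas by auto
    have "1 / real (Suc k') \<le> 1 / real (Suc k)" if "k \<le> k'" for k k'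
      using that by (intro divide_left_mono) auto
    then show "incseq B" by (fastforce simp: incseq_def B_def off_points_def intro: order_trans)
    show "X - l \<subseteq> (\<Union>k. B k)"
    proof
      fix b assume b: "b \<in> X - l"
      then have nz: "0 < \<bar>eta b\<bar>" using l_eta by simp
      obtain k :: nat where k: "max (1 / \<bar>eta b\<bar>) (max \<bar>eta b\<bar> \<bar>xi b\<bar>) \<le> k" using real_arch_simple by blast
      then have "1 / \<bar>eta b\<bar> \<le> real (Suc k)" by simp
      then have "1 / real (Suc k) \<le> \<bar>eta b\<bar>" using nz by (simp add: field_simps)
      then have "b \<in> B k" using b k by (auto simp: B_def off_points_def)
      then show "b \<in> (\<Union>k. B k)" by blast
    qed
  next
    fix k assume "\<And>j. k \<le> j \<Longrightarrow> 0 < emeasure \<nu> (B j)"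
    then show thesis by (rule that)
  qed
  define k where "k = max k1 k2"
  have "hausdorff_measure line_metric (s + u) (spanned_lines X) \<noteq> 0"
  proof (rule hausdorff_measure_spanned_lines_pos[where c = c and d = d, OF \<mu>(1) \<nu>(1) \<mu>(2) \<nu>(2)])
    show "A k \<in> sets borel" "B k \<in> sets borel"
      unfolding A_def B_def using assms(1) l_meas base_meas off_meas by auto
    show "A k \<subseteq> base_points (Suc k)" "B k \<subseteq> off_points (Suc k)" "A k \<subseteq> X" "B k \<subseteq> X"
      by (auto simp: A_def B_def)
    show "0 < emeasure \<mu> (A k)" "0 < emeasure \<nu> (B k)" using k1 k2 by (auto simp: k_def)
  qed (use u t1 \<mu> \<nu> in auto)
  moreover have "hausdorff_measure line_metric (s + u) (spanned_lines X) = 0"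
    using hausdorff_measure_eq_0_mono[OF s0(2,1) u(3)] .
  ultimately show False by simp
qed

end
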